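(* Let $A$ be a multiplicative divisor system with $n\in A(n)$ for all $n\in\mathbb N$, and let $\phi_A$ be the unique arithmetical function satisfying $\sum_{d\in A(n)}\phi_A(d)=n$ for all $n\ge1$. Assume that for each prime $p>2$ there is an exponent $e_p\in\mathbb N$ such that $p^{e_p-1}\in A(p^{e_p})$ and $e_p=p^{o(1)}$ as $p\to\infty$. Then $$\liminf_{n\to\infty}\frac{\phi_A(n)\log\log n}{n}=e^{-\gamma}\prod_p\Big(1-\frac1p\Big)^{-1}\inf_{\nu\ge0}\frac{\phi_A(p^\nu)}{p^\nu},$$ where $\gamma$ is Euler's constant; the product over the primes $p>2$ converges, while the factor for $p=2$ may vanish (in which case the right-hand side is $0$).
   Context: A divisor system $A$ assigns to each positive integer $n$ a set $A(n)$ of positive divisors of $n$. It is called multiplicative if not all $A(n)$ are empty and $A(n_1n_2)=A(n_1)A(n_2)=\{d_1d_2: d_1\in A(n_1),d_2\in A(n_2)\}$ whenever $\gcd(n_1,n_2)=1$. For a multiplicative $A$ with $n\in A(n)$ for all $n$, the equation $\sum_{d\in A(n)}\phi_A(d)=n$ ($n\ge1$) has a unique solution $\phi_A$, which is multiplicative with $1\le\phi_A(n)\le n$. *)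

theory Defs
  imports "HOL-Analysis.Analysis" "HOL-Computational_Algebra.Primes"
begin

text \<open>
  Arithmetical objects are functions on \<open>nat\<close> of which only the values at positive arguments
  matter; all conditions below are restricted to \<open>n \<ge> 1\<close>. In particular divisors of such
  an \<open>n\<close> are automatically positive.
\<close>

definition divisor_system :: "(nat \<Rightarrow> nat set) \<Rightarrow> bool" where
  "divisor_system A \<longleftrightarrow> (\<forall>n\<ge>1. A n \<subseteq> {d. d dvd n})"

definition multiplicative_system :: "(nat \<Rightarrow> nat set) \<Rightarrow> bool" where
  "multiplicative_system A \<longleftrightarrow>
     (\<exists>n\<ge>1. A n \<noteq> {}) \<and>
     (\<forall>m\<ge>1. \<forall>n\<ge>1. coprime m n \<longrightarrow> A (m * n) = {d1 * d2 | d1 d2. d1 \<in> A m \<and> d2 \<in> A n})"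

definition is_phi :: "(nat \<Rightarrow> nat set) \<Rightarrow> (nat \<Rightarrow> real) \<Rightarrow> bool" where
  "is_phi A f \<longleftrightarrow> (\<forall>n\<ge>1. (\<Sum>d\<in>A n. f d) = real n)"

text \<open>The filter of primes tending to infinity.\<close>

definition primes_at_top :: "nat filter" where
  "primes_at_top = inf at_top (principal {p. prime p})"

text \<open>
  \<open>e\<^sub>p = p\<^bsup>o(1)\<^esup>\<close>: for all large primes, \<open>e\<^sub>p = p\<^bsup>h(p)\<^esup>\<close> with \<open>h(p) \<longlonglongrightarrow> 0\<close>.
\<close>

definition subpolynomial_on_primes :: "(nat \<Rightarrow> nat) \<Rightarrow> bool" where
  "subpolynomial_on_primes e \<longleftrightarrow>
     (\<exists>h :: nat \<Rightarrow> real. (h \<longlongrightarrow> 0) primes_at_top \<and>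
        (\<forall>\<^sub>F p in primes_at_top. real (e p) = real p powr h p))"

text \<open>The requirement \<open>e p \<ge> 1\<close> makes the subtraction in \<open>e p - 1\<close> a genuine one.\<close>

definition exponent_condition :: "(nat \<Rightarrow> nat set) \<Rightarrow> bool" where
  "exponent_condition A \<longleftrightarrow>
     (\<exists>e :: nat \<Rightarrow> nat.
        (\<forall>p. prime p \<and> p > 2 \<longrightarrow> e p \<ge> 1 \<and> p ^ (e p - 1) \<in> A (p ^ e p)) \<and>
        subpolynomial_on_primes e)"

definition local_factor :: "(nat \<Rightarrow> real) \<Rightarrow> nat \<Rightarrow> real" where
  "local_factor f p = inverse (1 - 1 / real p) * (INF \<nu>::nat. f (p ^ \<nu>) / real (p ^ \<nu>))"

text \<open>
  The next two facts justify speaking of \<^emph>\<open>the\<close> function \<open>\<phi>\<^sub>A\<close>: the defining equation is solvable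
  and determines all values at positive arguments.
\<close>

lemma divisor_system_sum_split:
  assumes "divisor_system A" "n \<in> A n" "n \<ge> 1"
  shows "(\<Sum>d\<in>A n. f d) = f n + (\<Sum>d\<in>{d \<in> A n. d < n}. (f d :: real))"
proof -
  have sub: "A n \<subseteq> {d. d dvd n}"
    using assms by (auto simp: divisor_system_def)
  then have fin: "finite (A n)"
    using assms(3) by (auto intro: finite_subset)
  have "A n - {n} = {d \<in> A n. d < n}"
    using sub assms(3) by (auto dest!: dvd_imp_le)
  then show ?thesis
    using fin assms(2) by (simp add: sum.remove)
qed

lemma is_phi_unique:
  assumes "divisor_system A" "\<forall>n\<ge>1. n \<in> A n" "is_phi A f" "is_phi A g" "n \<ge> 1"
  shows "f n = g n"
  using assms(5)
proof (induction n rule: less_induct)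
  case (less n)
  have pos: "d \<ge> 1" if "d \<in> A n" for d
  proof -
    have "d dvd n"
      using that assms(1) less.prems unfolding divisor_system_def by blast
    then show ?thesis
      using less.prems by (cases d) auto
  qed
  have "(\<Sum>d\<in>{d \<in> A n. d < n}. f d) = (\<Sum>d\<in>{d \<in> A n. d < n}. g d)"
    by (rule sum.cong) (auto intro!: less.IH pos)
  moreover have "(\<Sum>d\<in>A n. f d) = (\<Sum>d\<in>A n. g d)"
    using assms(3,4) less.prems by (simp add: is_phi_def)
  ultimately show ?case
    using divisor_system_sum_split[of A n f] divisor_system_sum_split[of A n g] assms(1,2) less.prems
    by simp
qed

lemma is_phi_exists:
  assumes "divisor_system A" "\<forall>n\<ge>1. n \<in> A n"
  shows "\<exists>f. is_phi A f"
proof -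
  define F where "F = (\<lambda>(f :: nat \<Rightarrow> real) n. real n - (\<Sum>d\<in>{d \<in> A n. d < n}. f d))"
  define f where "f = wfrec less_than F"
  have "adm_wf less_than F"
    unfolding adm_wf_def F_def by (auto intro!: sum.cong)
  then have "f = F f"
    unfolding f_def by (intro wfrec_fixpoint wf_less_than)
  then have "f n = F f n" for n
    by (rule fun_cong)
  then have rec: "f n = real n - (\<Sum>d\<in>{d \<in> A n. d < n}. f d)" for n
    unfolding F_def .
  have "(\<Sum>d\<in>A n. f d) = real n" if "n \<ge> 1" for n
  proof -
    have "(\<Sum>d\<in>A n. f d) = f n + (\<Sum>d\<in>{d \<in> A n. d < n}. f d)"
      using assms that by (intro divisor_system_sum_split) auto
    then show ?thesis
      using rec[of n] by linarith
  qed
  then show ?thesis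
    by (auto simp: is_phi_def)
qed

end

theory Submission
  imports Defs "HOL-Real_Asymp.Real_Asymp"
begin

text \<open>
  For \<open>n\<close> with \<open>y = \<lfloor>ln n\<rfloor>\<close>, the prime divisors of \<open>n\<close> above \<open>y\<close> are so few that they change \<open>\<phi> n / n\<close> only
  by a factor tending to \<open>1\<close>, so \<open>\<phi> n / n\<close> is essentially bounded below by the product over \<open>p \<le> y\<close> of the
  infima of \<open>\<phi> (p ^ \<nu>) / p ^ \<nu>\<close>. Conversely, take the product over \<open>p \<le> y\<close> of powers of \<open>p\<close> that are nearly
  optimal for \<open>p \<le> k\<close> and have exponent \<open>e\<^sub>p\<close> for \<open>p > k\<close>: the latter lose only a factor
  \<open>1 + O (1 / p\<^sup>2)\<close>, and \<open>e\<^sub>p = p\<^bsup>o(1)\<^esup>\<close> keeps \<open>ln (ln n)\<close> below \<open>(1 + o(1)) ln y\<close>. Both bounds reduce the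
  claim to Mertens' third theorem.

  Mertens' theorem is obtained from \<open>\<delta> \<zeta>(1 + \<delta>) \<longlonglongrightarrow> 1\<close> by Karamata's method. The Laplace transforms of the
  weights \<open>- ln (1 - 1 / p)\<close> at \<open>ln p\<close> and of the weights \<open>1 / k\<close> at \<open>k\<close> are both \<open>- ln \<delta> + o(1)\<close>; polynomial
  approximation of a step function transfers this to the partial sums, and the partial sums of the second
  family are the harmonic numbers, which produce Euler's constant.
\<close>

section \<open>Karamata's comparison with the harmonic series\<close>

text \<open>\<open>w n\<close> is a mass placed at the point \<open>t n\<close>. The asymptotics in
  \<open>log_asymp\<close> are additive with error o(1); a mere asymptotic ratio would lose the
  constant in Mertens' theorem.\<close>

locale log_laplace =
  fixes w t :: "nat \<Rightarrow> real"
  assumes w_nonneg: "w n \<ge> 0"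
    and t_nonneg: "t n \<ge> 0"
    and summable_exp: "\<delta> > 0 \<Longrightarrow> summable (\<lambda>n. w n * exp (- (\<delta> * t n)))"
    and log_asymp: "((\<lambda>\<delta>. (\<Sum>n. w n * exp (- (\<delta> * t n))) + ln \<delta>) \<longlongrightarrow> 0) (at_right 0)"
begin

text \<open>Karamata's substitution z = \<open>exp (- (\<delta> * t n))\<close>: a positive power of
  z gives the Laplace transform at a multiple of \<delta>, and a cut-off function of z gives a
  partial sum of the weights.\<close>

definition wsum :: "(real \<Rightarrow> real) \<Rightarrow> real \<Rightarrow> real" where
  "wsum q \<delta> = (\<Sum>n. w n * q (exp (- (\<delta> * t n))))"

lemma exp_unit: "\<delta> > 0 \<Longrightarrow> exp (- (\<delta> * t n)) \<in> {0..1}"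
  using t_nonneg[of n] by simp

text \<open>The weights alone have infinite total mass, so a constant bound on \<open>q\<close>
  would not do; the factor z in the bound leads back to the convergent Laplace series.\<close>

lemma summable_wsum:
  assumes "\<delta> > 0" "\<And>z. z \<in> {0..1} \<Longrightarrow> \<bar>q z\<bar> \<le> C * z"
  shows "summable (\<lambda>n. w n * q (exp (- (\<delta> * t n))))"
proof (rule summable_comparison_test')
  show "summable (\<lambda>n. C * (w n * exp (- (\<delta> * t n))))"
    by (intro summable_mult summable_exp assms)
  show "norm (w n * q (exp (- (\<delta> * t n)))) \<le> C * (w n * exp (- (\<delta> * t n)))" if "n \<ge> 0" for n
    using mult_left_mono[OF assms(2)[OF exp_unit[OF assms(1), of n]] w_nonneg[of n]] w_nonneg[of n]
    by (simp add: abs_mult mult_ac)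
qed

lemma wsum_mono:
  assumes "\<delta> > 0" "\<And>z. z \<in> {0..1} \<Longrightarrow> \<bar>q z\<bar> \<le> C * z" "\<And>z. z \<in> {0..1} \<Longrightarrow> \<bar>r z\<bar> \<le> D * z"
    "\<And>z. z \<in> {0..1} \<Longrightarrow> q z \<le> r z"
  shows "wsum q \<delta> \<le> wsum r \<delta>"
  unfolding wsum_def
  using assms exp_unit w_nonneg
  by (intro suminf_le mult_left_mono summable_wsum) auto

lemma wsum_diff:
  assumes "\<delta> > 0" "\<And>z. z \<in> {0..1} \<Longrightarrow> \<bar>q z\<bar> \<le> C * z" "\<And>z. z \<in> {0..1} \<Longrightarrow> \<bar>r z\<bar> \<le> D * z"
  shows "wsum (\<lambda>z. q z - r z) \<delta> = wsum q \<delta> - wsum r \<delta>"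
  unfolding wsum_def
  using suminf_diff[OF summable_wsum[OF assms(1,2)] summable_wsum[OF assms(1,3)]]
  by (simp add: algebra_simps)

lemma wsum_monomial:
  assumes "\<delta> > 0"
  shows "(\<lambda>n. w n * exp (- (\<delta> * t n)) ^ Suc j) sums (\<Sum>n. w n * exp (- (real (Suc j) * \<delta> * t n)))"
proof -
  have "exp (- (\<delta> * t n)) ^ Suc j = exp (- (real (Suc j) * \<delta> * t n))" for n
    by (subst exp_of_nat_mult [symmetric]) (simp add: algebra_simps)
  then show ?thesis
    using summable_exp[of "real (Suc j) * \<delta>"] assms by (simp add: summable_sums)
qed

text \<open>The monomial z^(i+1) contributes the transform at (i+1) \<delta>, which is - ln \<delta>
  - ln (i+1) + o(1). Main term and constant depend only on the coefficients, not on \<open>w\<close>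
  and \<open>t\<close>, so they cancel between any two families.\<close>

lemma wsum_poly_asymp:
  "((\<lambda>\<delta>. wsum (\<lambda>z. z * (\<Sum>i\<le>m. a i * z ^ i)) \<delta> + (\<Sum>i\<le>m. a i) * ln \<delta>)
     \<longlongrightarrow> - (\<Sum>i\<le>m. a i * ln (real (Suc i)))) (at_right 0)"
proof -
  define G where "G = (\<lambda>\<delta>. \<Sum>n. w n * exp (- (\<delta> * t n)))"
  have eq: "wsum (\<lambda>z. z * (\<Sum>i\<le>m. a i * z ^ i)) \<delta> = (\<Sum>i\<le>m. a i * G (real (Suc i) * \<delta>))"
    if "\<delta> > 0" for \<delta>
  proof -
    have "(\<lambda>n. \<Sum>i\<le>m. a i * (w n * exp (- (\<delta> * t n)) ^ Suc i))
        sums (\<Sum>i\<le>m. a i * G (real (Suc i) * \<delta>))"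
      unfolding G_def using that by (intro sums_sum sums_mult wsum_monomial)
    also have "(\<lambda>n. \<Sum>i\<le>m. a i * (w n * exp (- (\<delta> * t n)) ^ Suc i)) =
        (\<lambda>n. w n * (exp (- (\<delta> * t n)) * (\<Sum>i\<le>m. a i * exp (- (\<delta> * t n)) ^ i)))"
      by (simp add: sum_distrib_left mult_ac)
    finally show ?thesis
      unfolding wsum_def by (simp add: sums_iff)
  qed
  have lim: "((\<lambda>\<delta>. G (real (Suc i) * \<delta>) + ln (real (Suc i) * \<delta>)) \<longlongrightarrow> 0) (at_right 0)" for i
  proof -
    have "filterlim (\<lambda>\<delta>. real (Suc i) * \<delta>) (at_right 0) (at_right 0)"
      by real_asymp
    from filterlim_compose[OF log_asymp this] show ?thesis
      by (simp add: G_def)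
  qed
  have "((\<lambda>\<delta>. \<Sum>i\<le>m. a i * (G (real (Suc i) * \<delta>) + ln (real (Suc i) * \<delta>)) - a i * ln (real (Suc i)))
      \<longlongrightarrow> (\<Sum>i\<le>m. a i * 0 - a i * ln (real (Suc i)))) (at_right 0)"
    by (intro tendsto_intros lim)
  also have "(\<Sum>i\<le>m. a i * 0 - a i * ln (real (Suc i))) = - (\<Sum>i\<le>m. a i * ln (real (Suc i)))"
    by (simp add: sum_negf)
  finally show ?thesis
  proof (rule Lim_transform_eventually)
    show "\<forall>\<^sub>F \<delta> in at_right 0.
        (\<Sum>i\<le>m. a i * (G (real (Suc i) * \<delta>) + ln (real (Suc i) * \<delta>)) - a i * ln (real (Suc i))) =
        wsum (\<lambda>z. z * (\<Sum>i\<le>m. a i * z ^ i)) \<delta> + (\<Sum>i\<le>m. a i) * ln \<delta>"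
      using eventually_at_right_less[of 0]
    proof eventually_elim
      case (elim \<delta>)
      then show ?case
        by (simp add: eq ln_mult sum_distrib_right flip: sum.distrib) (simp add: algebra_simps)
    qed
  qed
qed

end

section \<open>The comparison family: weights 1/k at the points k\<close>

lemma harmonic_laplace_sums:
  assumes "\<delta> > 0"
  shows "(\<lambda>n. 1 / real n * exp (- (\<delta> * real n))) sums (- ln (1 - exp (- \<delta>)))"
proof -
  define z where "z = exp (- \<delta>)"
  have z: "0 < z" "z < 1"
    using assms by (auto simp: z_def)
  have "(\<lambda>n. z ^ n / of_nat n) sums (- ln (1 - z))"
    using z sums_minus[OF ln_series'[of "- z"]] by simp
  moreover have "z ^ n = exp (- (\<delta> * real n))" for n
    by (simp add: z_def mult.commute flip: exp_of_nat_mult)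
  ultimately show ?thesis
    by (simp add: z_def)
qed

interpretation harmonic: log_laplace "\<lambda>n. 1 / real n" real
proof
  show "summable (\<lambda>n. 1 / real n * exp (- (\<delta> * real n)))" if "\<delta> > 0" for \<delta>
    using harmonic_laplace_sums[OF that] by (simp add: sums_iff)
  have "((\<lambda>\<delta>::real. - ln (1 - exp (- \<delta>)) + ln \<delta>) \<longlongrightarrow> 0) (at_right 0)"
    by real_asymp
  then show "((\<lambda>\<delta>. (\<Sum>n. 1 / real n * exp (- (\<delta> * real n))) + ln \<delta>) \<longlongrightarrow> 0) (at_right 0)"
  proof (rule Lim_transform_eventually)
    show "\<forall>\<^sub>F \<delta> in at_right 0. - ln (1 - exp (- \<delta>)) + ln \<delta> =
        (\<Sum>n. 1 / real n * exp (- (\<delta> * real n))) + ln \<delta>"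
      using eventually_at_right_less[of 0]
      by eventually_elim (use harmonic_laplace_sums in \<open>simp add: sums_iff\<close>)
  qed
qed auto

text \<open>From 1 - exp (- \<delta> n) \<le> \<delta> n, the factor 1 - z turns the weight 1/n into
  at most \<delta>. What remains is a combination of geometric series, which can be summed
  exactly.\<close>

lemma harmonic_wsum_le:
  assumes "\<delta> > 0" and r: "\<And>z. z \<in> {0..1} \<Longrightarrow> 0 \<le> (\<Sum>i\<le>m. a i * z ^ i)"
  shows "harmonic.wsum (\<lambda>z. z * (1 - z) * (\<Sum>i\<le>m. a i * z ^ i)) \<delta>
    \<le> (\<Sum>i\<le>m. a i * (\<delta> / (exp (real (Suc i) * \<delta>) - 1)))"
proof -
  have "(\<lambda>n. exp (- (real (Suc i) * \<delta>)) * exp (- (real (Suc i) * \<delta>)) ^ n) sums (1 / (exp (real (Suc i) * \<delta>) - 1))" for i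
  proof -
    have "norm (exp (- (real (Suc i) * \<delta>))) < 1"
      using assms(1) by simp
    moreover have "exp (- (real (Suc i) * \<delta>)) * (1 / (1 - exp (- (real (Suc i) * \<delta>)))) =
        1 / (exp (real (Suc i) * \<delta>) - 1)"
      unfolding exp_minus using assms(1) by (simp del: of_nat_Suc add: divide_simps)
    ultimately show ?thesis
      using sums_mult[OF geometric_sums, of "exp (- (real (Suc i) * \<delta>))" "exp (- (real (Suc i) * \<delta>))"]
      by (simp del: of_nat_Suc)
  qed
  then have "(\<lambda>n. \<Sum>i\<le>m. a i * (\<delta> * (exp (- (real (Suc i) * \<delta>)) ^ Suc n)))
      sums (\<Sum>i\<le>m. a i * (\<delta> * (1 / (exp (real (Suc i) * \<delta>) - 1))))"
    by (intro sums_sum sums_mult) simp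
  also have "(\<lambda>n. \<Sum>i\<le>m. a i * (\<delta> * (exp (- (real (Suc i) * \<delta>)) ^ Suc n))) =
      (\<lambda>n. \<delta> * exp (- (\<delta> * real (Suc n))) * (\<Sum>i\<le>m. a i * exp (- (\<delta> * real (Suc n))) ^ i))"
  proof
    fix n
    have "exp (- (real (Suc i) * \<delta>)) ^ Suc n = exp (- (\<delta> * real (Suc n))) * exp (- (\<delta> * real (Suc n))) ^ i" for i
      unfolding power_Suc[symmetric] exp_of_nat_mult[symmetric] by (simp add: algebra_simps flip: exp_add)
    then show "(\<Sum>i\<le>m. a i * (\<delta> * (exp (- (real (Suc i) * \<delta>)) ^ Suc n))) =
        \<delta> * exp (- (\<delta> * real (Suc n))) * (\<Sum>i\<le>m. a i * exp (- (\<delta> * real (Suc n))) ^ i)"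
      by (simp add: sum_distrib_left mult_ac)
  qed
  finally have sums: "(\<lambda>n. \<delta> * exp (- (\<delta> * real (Suc n))) * (\<Sum>i\<le>m. a i * exp (- (\<delta> * real (Suc n))) ^ i))
      sums (\<Sum>i\<le>m. a i * (\<delta> * (1 / (exp (real (Suc i) * \<delta>) - 1))))" .
  have le: "1 / real n * (exp (- (\<delta> * real n)) * (1 - exp (- (\<delta> * real n))) * (\<Sum>i\<le>m. a i * exp (- (\<delta> * real n)) ^ i))
      \<le> \<delta> * exp (- (\<delta> * real n)) * (\<Sum>i\<le>m. a i * exp (- (\<delta> * real n)) ^ i)" (is "_ * (?e * _ * ?r) \<le> _") for n
  proof -
    have "1 / real n * (1 - ?e) \<le> \<delta>"
      using exp_ge_add_one_self[of "- (\<delta> * real n)"] assms(1) by (simp add: divide_simps)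
    moreover have "?e * ?r \<ge> 0"
      using r harmonic.exp_unit[OF assms(1), of n] by simp
    ultimately show ?thesis
      using mult_right_mono[of "1 / real n * (1 - ?e)" \<delta> "?e * ?r"] by (simp add: mult_ac)
  qed
  have bound: "\<bar>\<Sum>i\<le>m. a i * z ^ i\<bar> \<le> (\<Sum>i\<le>m. \<bar>a i\<bar>)" if "z \<in> {0..1}" for z :: real
    using that by (intro order.trans[OF sum_abs] sum_mono) (simp add: abs_mult mult_left_le power_le_one)
  have summ: "summable (\<lambda>n. 1 / real n * (exp (- (\<delta> * real n)) * (1 - exp (- (\<delta> * real n))) * (\<Sum>i\<le>m. a i * exp (- (\<delta> * real n)) ^ i)))"
  proof (rule harmonic.summable_wsum[where C = "\<Sum>i\<le>m. \<bar>a i\<bar>"])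
    fix z :: real assume z: "z \<in> {0..1}"
    have "\<bar>z * (1 - z) * (\<Sum>i\<le>m. a i * z ^ i)\<bar> = z * ((1 - z) * \<bar>\<Sum>i\<le>m. a i * z ^ i\<bar>)"
      using z by (simp add: abs_mult)
    also have "\<dots> \<le> z * (1 * (\<Sum>i\<le>m. \<bar>a i\<bar>))"
      using z bound[OF z] by (intro mult_left_mono mult_mono) auto
    finally show "\<bar>z * (1 - z) * (\<Sum>i\<le>m. a i * z ^ i)\<bar> \<le> (\<Sum>i\<le>m. \<bar>a i\<bar>) * z"
      by (simp add: mult_ac)
  qed fact
  define f where "f = (\<lambda>n. 1 / real n * (exp (- (\<delta> * real n)) * (1 - exp (- (\<delta> * real n))) *
    (\<Sum>i\<le>m. a i * exp (- (\<delta> * real n)) ^ i)))"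
  \<comment> \<open>The term n = 0 vanishes because \<open>1 / real 0 = 0\<close>, so the series may
    be started at n = 1 to match the geometric series.\<close>
  have "(\<lambda>n. f (Suc n)) sums suminf f"
    using summable_sums[OF summ] unfolding f_def[symmetric] by (simp add: sums_Suc_iff) (simp add: f_def)
  then have "suminf f \<le> (\<Sum>i\<le>m. a i * (\<delta> * (1 / (exp (real (Suc i) * \<delta>) - 1))))"
    by (rule sums_le[rotated, OF _ sums]) (unfold f_def, rule le)
  then show ?thesis
    by (simp add: harmonic.wsum_def f_def)
qed

text \<open>As \<delta> tends to 0, \<delta> / (exp ((i+1) \<delta>) - 1) tends to 1/(i+1), the
  integral of z^i over the unit interval. Hence the error is controlled by an L1 norm, which can be
  small despite the jump of the step function.\<close>

lemma harmonic_wsum_real_polynomial: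
  assumes "real_polynomial_function r" "\<And>z. z \<in> {0..1} \<Longrightarrow> 0 \<le> r z"
  obtains K where "(K \<longlongrightarrow> integral {0..1} r) (at_right 0)"
    and "\<And>\<delta>. \<delta> > 0 \<Longrightarrow> harmonic.wsum (\<lambda>z. z * (1 - z) * r z) \<delta> \<le> K \<delta>"
proof -
  obtain a m where r: "r = (\<lambda>z. \<Sum>i\<le>m. a i * z ^ i)"
    using assms(1) by (auto simp: real_polynomial_function_iff_sum)
  define K where "K = (\<lambda>\<delta>. \<Sum>i\<le>m. a i * (\<delta> / (exp (real (Suc i) * \<delta>) - 1)))"
  have "(K \<longlongrightarrow> (\<Sum>i\<le>m. a i * (1 / real (Suc i)))) (at_right 0)"
    unfolding K_def
  proof (intro tendsto_sum tendsto_mult_left)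
    fix i
    have "((\<lambda>\<delta>. \<delta> / (exp (c * \<delta>) - 1)) \<longlongrightarrow> inverse c) (at_right 0)" if "c > 0" for c :: real
      using that by real_asymp
    then show "((\<lambda>\<delta>. \<delta> / (exp (real (Suc i) * \<delta>) - 1)) \<longlongrightarrow> 1 / real (Suc i)) (at_right 0)"
      unfolding inverse_eq_divide by simp
  qed
  also have "((\<lambda>z. \<Sum>i\<le>m. a i * z ^ i) has_integral (\<Sum>i\<le>m. a i * (1 / real (Suc i)))) {0..1}"
  proof (intro has_integral_sum has_integral_mult_right)
    fix i
    have "((\<lambda>z::real. z ^ i) has_integral (1 ^ Suc i / real (Suc i) - 0 ^ Suc i / real (Suc i))) {0..1}"
      by (rule fundamental_theorem_of_calculus)
        (auto intro!: derivative_eq_intros simp flip: has_real_derivative_iff_has_vector_derivative simp del: of_nat_Suc power_Suc)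
    then show "((\<lambda>z::real. z ^ i) has_integral 1 / real (Suc i)) {0..1}"
      by (simp del: of_nat_Suc)
  qed simp
  then have "(\<Sum>i\<le>m. a i * (1 / real (Suc i))) = integral {0..1} r"
    unfolding r by (simp add: integral_unique)
  finally show ?thesis
    using that[of K] harmonic_wsum_le[of _ a m] assms(2) by (simp add: K_def r)
qed

section \<open>From polynomials to the step function\<close>

lemma real_polynomial_function_bounded_unit:
  fixes p :: "real \<Rightarrow> real"
  assumes "real_polynomial_function p"
  shows "\<exists>C. \<forall>z\<in>{0..1}. \<bar>p z\<bar> \<le> C"
proof -
  have "compact (p ` {0..1})"
    using assms by (intro compact_continuous_image continuous_on_polymonial_function)
      (auto simp: real_polynomial_function_eq)
  then obtain C where "\<forall>x\<in>p ` {0..1}. norm x \<le> C"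
    using compact_imp_bounded bounded_iff by metis
  then show ?thesis
    by auto
qed

lemma (in log_laplace) wsum_polynomial_harmonic:
  assumes "real_polynomial_function p"
  shows "((\<lambda>\<delta>. wsum (\<lambda>z. z * p z) \<delta> - harmonic.wsum (\<lambda>z. z * p z) \<delta>) \<longlongrightarrow> 0) (at_right 0)"
proof -
  obtain a m where p: "p = (\<lambda>z. \<Sum>i\<le>m. a i * z ^ i)"
    using assms by (auto simp: real_polynomial_function_iff_sum)
  from tendsto_diff[OF wsum_poly_asymp[of a m] harmonic.wsum_poly_asymp[of a m]]
  show ?thesis
    by (simp add: p)
qed

text \<open>\<open>exp (- (\<delta> * t)) \<ge> exp (- 1)\<close> means t \<le> 1 / \<delta>, so
  \<open>wsum step (1 / X)\<close> is the sum of the weights at points up to X, endpoint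
  included.\<close>

definition step :: "real \<Rightarrow> real" where
  "step z = (if z < exp (- 1) then 0 else 1)"

text \<open>
  Writing the step function as \<open>z (1 + (1 - z) h z)\<close> and approximating \<open>h\<close> makes the approximating
  polynomials vanish at \<open>0\<close> and equal \<open>1\<close> at \<open>1\<close>. The error then contains \<open>z (1 - z)\<close> at
  \<open>z = exp (- \<delta> k)\<close>, and \<open>(1 - z) / k \<le> \<delta>\<close> turns the harmonic sum of the error into a Riemann sum.
\<close>

definition step_quotient :: "real \<Rightarrow> real" where
  "step_quotient z = (if z < exp (- 1) then - 1 / (1 - z) else 1 / z)"

lemma step_eq: "step z = z * (1 + (1 - z) * step_quotient z)" if "z \<noteq> 1"
proof -
  have "z \<noteq> 0" if "z \<ge> exp (- 1)"
    using that by (metis exp_gt_zero not_le)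
  then show ?thesis
    using that by (auto simp: step_def step_quotient_def field_simps)
qed

lemma step_one: "step 1 = 1"
  by (simp add: step_def)

text \<open>The only discontinuity is an upward jump at \<open>exp (- 1)\<close>. A ramp just to its
  right gives a continuous minorant, a ramp just to its left a continuous majorant, and
  Stone-Weierstrass replaces both by polynomials.\<close>

lemma step_quotient_sandwich:
  assumes "\<epsilon> > 0"
  obtains p q where "real_polynomial_function p" "real_polynomial_function q"
    "\<And>z. z \<in> {0..1} \<Longrightarrow> p z \<le> step_quotient z" "\<And>z. z \<in> {0..1} \<Longrightarrow> step_quotient z \<le> q z"
    "integral {0..1} (\<lambda>z. q z - p z) \<le> \<epsilon>"
proof -
  define a :: real where "a = exp (- 1)"
  have a: "0 < a" "a < 1"
    by (auto simp: a_def)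
  define K where "K = 1 / a + 1 / (1 - a)"
  have K: "K > 0"
    using a by (simp add: K_def add_pos_pos)
  \<comment> \<open>\<open>K\<close> bounds the height of the jump. The two ramps differ only on a
    window of length 2 \<eta>, and this choice makes its contribution 2 K \<eta> equal to
    \<epsilon>/2.\<close>
  define \<eta> where "\<eta> = \<epsilon> / (4 * K)"
  have \<eta>: "\<eta> > 0"
    using K assms by (simp add: \<eta>_def)
  \<comment> \<open>The two branches, extended continuously past the jump by freezing their argument
    at \<open>a\<close>; this keeps them away from their poles at 1 and 0.\<close>
  define lo hi where "lo = (\<lambda>z. - 1 / (1 - min z a))" and "hi = (\<lambda>z. 1 / max z a)"
  have "1 - min z a \<noteq> 0" "max z a \<noteq> 0" for z
    using a by (auto simp: min_def max_def)
  then have cont_lohi: "continuous_on {0..1} lo" "continuous_on {0..1} hi"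
    unfolding lo_def hi_def by (auto intro!: continuous_intros)
  have lo0: "lo z \<le> 0" and hi0: "hi z \<ge> 0" for z
    using a by (auto simp: lo_def hi_def min_def max_def divide_simps)
  have hilo: "hi z - lo z \<le> K" for z
  proof -
    have "1 / max z a \<le> 1 / a" "1 / (1 - min z a) \<le> 1 / (1 - a)"
      using a by (auto intro!: divide_left_mono mult_pos_pos)
    then show ?thesis
      by (simp add: K_def lo_def hi_def)
  qed
  define c where "c = (\<lambda>z. max 0 (min 1 ((z - a) / \<eta>)))"
  define d where "d = (\<lambda>z. max 0 (min 1 ((z - a) / \<eta> + 1)))"
  have cont_cd: "continuous_on {0..1} c" "continuous_on {0..1} d"
    unfolding c_def d_def by (intro continuous_intros; use \<eta> in simp)+
  have c: "0 \<le> c z" "c z \<le> 1" and d: "0 \<le> d z" "d z \<le> 1" for z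
    by (auto simp: c_def d_def)
  have c0: "c z = 0" if "z < a" for z
    using that \<eta> by (simp add: c_def divide_simps min_def max_def)
  have d1: "d z = 1" if "z \<ge> a" for z
    using that \<eta> by (simp add: d_def min_def max_def divide_simps)
  have cd: "d z - c z \<le> (if z \<in> {a - \<eta>..a + \<eta>} then 1 else 0)" for z
    using \<eta> by (auto simp: c_def d_def min_def max_def divide_simps split: if_splits)
  \<comment> \<open>The shift by \<epsilon>/8 absorbs the approximation error of \<epsilon>/8, so
    each polynomial stays on its side of \<open>step_quotient\<close>. Shifts and errors together
    account for the other \<epsilon>/2.\<close>
  define P where "P = (\<lambda>z. lo z + c z * (hi z - lo z) - \<epsilon> / 8)"
  define Q where "Q = (\<lambda>z. lo z + d z * (hi z - lo z) + \<epsilon> / 8)"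
  have "continuous_on {0..1} P" "continuous_on {0..1} Q"
    unfolding P_def Q_def by (intro continuous_intros cont_lohi cont_cd)+
  then obtain p q where p: "real_polynomial_function p" "\<And>z. z \<in> {0..1} \<Longrightarrow> \<bar>P z - p z\<bar> < \<epsilon> / 8"
    and q: "real_polynomial_function q" "\<And>z. z \<in> {0..1} \<Longrightarrow> \<bar>Q z - q z\<bar> < \<epsilon> / 8"
    using Stone_Weierstrass_real_polynomial_function[of "{0..1}" _ "\<epsilon> / 8"] assms
    by (metis compact_Icc divide_pos_pos zero_less_numeral)
  have pz: "p z \<le> step_quotient z" if z: "z \<in> {0..1}" for z
  proof (cases "z < a")
    case True
    then have "P z = step_quotient z - \<epsilon> / 8"
      by (simp add: P_def c0 step_quotient_def lo_def flip: a_def)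
    then show ?thesis
      using p(2)[OF z] by linarith
  next
    case False
    have "c z * (hi z - lo z) \<le> 1 * (hi z - lo z)"
      using c lo0[of z] hi0[of z] by (intro mult_right_mono) auto
    then have "P z \<le> step_quotient z - \<epsilon> / 8"
      using False by (simp add: P_def step_quotient_def hi_def max_def flip: a_def)
    then show ?thesis
      using p(2)[OF z] by linarith
  qed
  have qz: "step_quotient z \<le> q z" if z: "z \<in> {0..1}" for z
  proof (cases "z < a")
    case True
    have "0 \<le> d z * (hi z - lo z)"
      using d[of z] lo0[of z] hi0[of z] by simp
    then have "step_quotient z + \<epsilon> / 8 \<le> Q z"
      using True by (simp add: Q_def step_quotient_def lo_def flip: a_def)
    then show ?thesis
      using q(2)[OF z] by linarith
  next
    case False
    then have "Q z = step_quotient z + \<epsilon> / 8"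
      by (simp add: Q_def d1 step_quotient_def hi_def max_def flip: a_def)
    then show ?thesis
      using q(2)[OF z] by linarith
  qed
  have diff: "q z - p z \<le> K * (if z \<in> {a - \<eta>..a + \<eta>} then 1 else 0) + \<epsilon> / 2" if z: "z \<in> {0..1}" for z
  proof -
    have "(d z - c z) * (hi z - lo z) \<le> (if z \<in> {a - \<eta>..a + \<eta>} then 1 else 0) * K"
      using cd[of z] hilo[of z] lo0[of z] hi0[of z] K by (intro mult_mono) auto
    then have "Q z - P z \<le> K * (if z \<in> {a - \<eta>..a + \<eta>} then 1 else 0) + \<epsilon> / 4"
      by (simp add: P_def Q_def algebra_simps)
    then show ?thesis
      using p(2)[OF z] q(2)[OF z] by linarith
  qed
  \<comment> \<open>The window may stick out of the unit interval, hence the intersection; its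
    length is still at most 2 \<eta>.\<close>
  have int: "((\<lambda>z. K * (if z \<in> {a - \<eta>..a + \<eta>} then 1 else 0) + \<epsilon> / 2) has_integral
      (K * integral ({a - \<eta>..a + \<eta>} \<inter> {0..1}) (\<lambda>_. 1) + \<epsilon> / 2)) {0..1}"
  proof -
    have "((\<lambda>z::real. if z \<in> {a - \<eta>..a + \<eta>} then 1 else 0) has_integral
        integral ({a - \<eta>..a + \<eta>} \<inter> {0..1}) (\<lambda>_. 1 :: real)) {0..1}"
      by (subst has_integral_restrict_Int)
        (rule integrable_integral, simp only: Int_atLeastAtMost integrable_const_ivl)
    from has_integral_add[OF has_integral_mult_right[OF this, of K] has_integral_const_real[of "\<epsilon> / 2" 0 1]]
    show ?thesis
      by simp
  qed
  have "integral ({a - \<eta>..a + \<eta>} \<inter> {0..1}) (\<lambda>_. 1 :: real) \<le> integral {a - \<eta>..a + \<eta>} (\<lambda>_. 1)"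
    by (intro integral_subset_le) auto
  then have len: "integral ({a - \<eta>..a + \<eta>} \<inter> {0..1}) (\<lambda>_. 1 :: real) \<le> 2 * \<eta>"
    using \<eta> by simp
  have "(\<lambda>z. q z - p z) integrable_on {0..1}"
    using p(1) q(1) by (intro integrable_continuous_real continuous_intros continuous_on_polymonial_function)
      (auto simp: real_polynomial_function_eq)
  then have "integral {0..1} (\<lambda>z. q z - p z) \<le> K * integral ({a - \<eta>..a + \<eta>} \<inter> {0..1}) (\<lambda>_. 1) + \<epsilon> / 2"
    using diff by (intro has_integral_le[OF integrable_integral int]) auto
  also have "\<dots> \<le> K * (2 * \<eta>) + \<epsilon> / 2"
    using len K by simp
  also have "\<dots> = \<epsilon>"
    using K by (simp add: \<eta>_def)
  finally show ?thesis
    using that[OF p(1) q(1) pz qz] by blast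
qed

text \<open>With P \<le> step \<le> Q, the difference is at most (\<open>wsum Q\<close> -
  \<open>harmonic.wsum Q\<close>) + \<open>harmonic.wsum (Q - P)\<close>, and symmetrically from
  below. The first bracket tends to 0, so a small error is required only for the explicit harmonic
  weights.\<close>

theorem (in log_laplace) wsum_step_harmonic:
  "((\<lambda>\<delta>. wsum step \<delta> - harmonic.wsum step \<delta>) \<longlongrightarrow> 0) (at_right 0)"
proof (rule tendstoI)
  fix \<epsilon> :: real assume \<epsilon>: "\<epsilon> > 0"
  obtain p q where p: "real_polynomial_function p" and q: "real_polynomial_function q"
    and pz: "\<And>z. z \<in> {0..1} \<Longrightarrow> p z \<le> step_quotient z" and qz: "\<And>z. z \<in> {0..1} \<Longrightarrow> step_quotient z \<le> q z"
    and int: "integral {0..1} (\<lambda>z. q z - p z) \<le> \<epsilon> / 3"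
    using step_quotient_sandwich[of "\<epsilon> / 3"] \<epsilon> by auto
  define P where "P = (\<lambda>z. z * (1 + (1 - z) * p z))"
  define Q where "Q = (\<lambda>z. z * (1 + (1 - z) * q z))"
  have "real_polynomial_function (\<lambda>z. 1 + (1 - z) * r z)" if "real_polynomial_function r" for r :: "real \<Rightarrow> real"
  proof -
    have "real_polynomial_function (\<lambda>z::real. 1 - z)"
      by (rule real_polynomial_function_diff[OF real_polynomial_function.intros(2)
            real_polynomial_function.intros(1)[OF bounded_linear_ident]])
    then show ?thesis
      by (rule real_polynomial_function.intros(3)[OF real_polynomial_function.intros(2)
            real_polynomial_function.intros(4)[OF _ that]])
  qed
  note poly = this[OF p] this[OF q]
  have PQ: "P z \<le> step z \<and> step z \<le> Q z" if z: "z \<in> {0..1}" for z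
  proof (cases "z = 1")
    case False
    then show ?thesis
      unfolding step_eq[OF False] P_def Q_def using pz[OF z] qz[OF z] z
      by (auto intro!: mult_left_mono add_left_mono)
  qed (simp add: step_one P_def Q_def)
  obtain C where C: "\<And>z. z \<in> {0..1} \<Longrightarrow> \<bar>1 + (1 - z) * p z\<bar> \<le> C"
    using real_polynomial_function_bounded_unit[OF poly(1)] by blast
  obtain D where D: "\<And>z. z \<in> {0..1} \<Longrightarrow> \<bar>1 + (1 - z) * q z\<bar> \<le> D"
    using real_polynomial_function_bounded_unit[OF poly(2)] by blast
  have PC: "\<bar>P z\<bar> \<le> C * z" and QD: "\<bar>Q z\<bar> \<le> D * z" if "z \<in> {0..1}" for z
    using mult_left_mono[OF C[OF that], of z] mult_left_mono[OF D[OF that], of z] that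
    by (auto simp: P_def Q_def abs_mult mult_ac)
  have step_bd: "\<bar>step z\<bar> \<le> exp 1 * z" if "z \<in> {0..1}" for z
  proof (cases "z < exp (- 1)")
    case False
    then have "exp 1 * exp (- 1) \<le> exp 1 * z"
      by simp
    then show ?thesis
      using False by (simp add: step_def flip: exp_add)
  qed (use that in \<open>simp add: step_def\<close>)
  have r: "real_polynomial_function (\<lambda>z. q z - p z)"
    by (rule real_polynomial_function_diff[OF q p])
  obtain K where K: "(K \<longlongrightarrow> integral {0..1} (\<lambda>z. q z - p z)) (at_right 0)"
    "\<And>\<delta>. \<delta> > 0 \<Longrightarrow> harmonic.wsum (\<lambda>z. z * (1 - z) * (q z - p z)) \<delta> \<le> K \<delta>"
    using harmonic_wsum_real_polynomial[OF r] order.trans[OF pz qz] by auto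
  have evK: "\<forall>\<^sub>F \<delta> in at_right 0. K \<delta> < \<epsilon> / 2"
    using int \<epsilon> by (intro order_tendstoD(2)[OF K(1)]) simp
  have evP: "\<forall>\<^sub>F \<delta> in at_right 0. wsum P \<delta> - harmonic.wsum P \<delta> > - (\<epsilon> / 2)"
    unfolding P_def using \<epsilon> by (intro order_tendstoD(1)[OF wsum_polynomial_harmonic[OF poly(1)]]) simp
  have evQ: "\<forall>\<^sub>F \<delta> in at_right 0. wsum Q \<delta> - harmonic.wsum Q \<delta> < \<epsilon> / 2"
    unfolding Q_def using \<epsilon> by (intro order_tendstoD(2)[OF wsum_polynomial_harmonic[OF poly(2)]]) simp
  show "\<forall>\<^sub>F \<delta> in at_right 0. dist (wsum step \<delta> - harmonic.wsum step \<delta>) 0 < \<epsilon>"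
    using evK evP evQ eventually_at_right_less[of 0]
  proof eventually_elim
    case (elim \<delta>)
    have "harmonic.wsum Q \<delta> - harmonic.wsum P \<delta> = harmonic.wsum (\<lambda>z. Q z - P z) \<delta>"
      using harmonic.wsum_diff[OF \<open>\<delta> > 0\<close> QD PC] by simp
    also have "(\<lambda>z. Q z - P z) = (\<lambda>z. z * (1 - z) * (q z - p z))"
      by (simp add: P_def Q_def algebra_simps)
    also have "harmonic.wsum \<dots> \<delta> < \<epsilon> / 2"
      using K(2)[OF \<open>\<delta> > 0\<close>] elim(1) by simp
    finally have "harmonic.wsum Q \<delta> - harmonic.wsum P \<delta> < \<epsilon> / 2" .
    moreover have "wsum P \<delta> \<le> wsum step \<delta>" "harmonic.wsum P \<delta> \<le> harmonic.wsum step \<delta>"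
      using PQ wsum_mono[OF \<open>\<delta> > 0\<close> PC step_bd] harmonic.wsum_mono[OF \<open>\<delta> > 0\<close> PC step_bd] by auto
    moreover have "wsum step \<delta> \<le> wsum Q \<delta>" "harmonic.wsum step \<delta> \<le> harmonic.wsum Q \<delta>"
      using PQ wsum_mono[OF \<open>\<delta> > 0\<close> step_bd QD] harmonic.wsum_mono[OF \<open>\<delta> > 0\<close> step_bd QD] by auto
    ultimately show ?case
      using elim(2,3) unfolding dist_real_def by linarith
  qed
qed

section \<open>Mertens' third theorem\<close>

text \<open>\<open>0 powr - s\<close> is 0, so the term n = 0 is harmless and this is the Riemann
  zeta function for s > 1.\<close>

definition zeta_real :: "real \<Rightarrow> real" where
  "zeta_real s = (\<Sum>n. real n powr - s)"

lemma summable_zeta: "s > 1 \<Longrightarrow> summable (\<lambda>n. real n powr - s)"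
  using summable_real_powr_iff[of "- s"] by simp

text \<open>The quotient is the integral of u^(-1-\<delta>) over [x, x+1], evaluated by the mean
  value theorem. Summed over x it telescopes to 1/\<delta>, which gives the integral test for
  zeta.\<close>

lemma powr_telescope_bounds:
  fixes x \<delta> :: real
  assumes "x > 0" "\<delta> > 0"
  shows "(x + 1) powr - (1 + \<delta>) \<le> (x powr - \<delta> - (x + 1) powr - \<delta>) / \<delta>"
    and "(x powr - \<delta> - (x + 1) powr - \<delta>) / \<delta> \<le> x powr - (1 + \<delta>)"
proof -
  have "\<exists>z>x. z < x + 1 \<and> (x + 1) powr - \<delta> - x powr - \<delta> = (x + 1 - x) * (- \<delta> * z powr (- \<delta> - 1))"
    using assms by (intro MVT2) (auto intro!: derivative_eq_intros)
  then obtain z where z: "x < z" "z < x + 1"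
    and "(x + 1) powr - \<delta> - x powr - \<delta> = - \<delta> * z powr (- \<delta> - 1)"
    by auto
  then have eq: "(x powr - \<delta> - (x + 1) powr - \<delta>) / \<delta> = z powr - (1 + \<delta>)"
    using assms by (simp add: field_simps minus_diff_commute)
  show "(x + 1) powr - (1 + \<delta>) \<le> (x powr - \<delta> - (x + 1) powr - \<delta>) / \<delta>"
    and "(x powr - \<delta> - (x + 1) powr - \<delta>) / \<delta> \<le> x powr - (1 + \<delta>)"
    unfolding eq using z assms by (auto intro!: powr_mono2')
qed

lemma zeta_real_bounds:
  assumes "\<delta> > 0"
  shows "1 / \<delta> \<le> zeta_real (1 + \<delta>)" "zeta_real (1 + \<delta>) \<le> 1 + 1 / \<delta>"
proof -
  define f where "f = (\<lambda>n. real n powr - (1 + \<delta>))"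
  have f: "f sums zeta_real (1 + \<delta>)"
    using summable_zeta[of "1 + \<delta>"] assms by (simp add: f_def zeta_real_def summable_sums)
  then have f1: "(\<lambda>n. f (Suc n)) sums zeta_real (1 + \<delta>)"
    using sums_Suc_iff[of f "zeta_real (1 + \<delta>)"] by (simp add: f_def)
  then have f2: "(\<lambda>n. f (Suc (Suc n))) sums (zeta_real (1 + \<delta>) - 1)"
    using sums_Suc_iff[of "\<lambda>n. f (Suc n)"] by (simp add: f_def)
  have "(\<lambda>n. real (Suc n) powr - \<delta>) \<longlonglongrightarrow> 0"
    using assms by real_asymp
  from sums_divide[OF telescope_sums'[OF this], of \<delta>]
  have tel: "(\<lambda>n. (real (Suc n) powr - \<delta> - (real (Suc n) + 1) powr - \<delta>) / \<delta>) sums (1 / \<delta>)"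
    by (simp add: add_ac)
  show "1 / \<delta> \<le> zeta_real (1 + \<delta>)"
    by (rule sums_le[OF _ tel f1]) (unfold f_def, rule powr_telescope_bounds, use assms in auto)
  have "zeta_real (1 + \<delta>) - 1 \<le> 1 / \<delta>"
  proof (rule sums_le[OF _ f2 tel])
    show "f (Suc (Suc n)) \<le> (real (Suc n) powr - \<delta> - (real (Suc n) + 1) powr - \<delta>) / \<delta>" for n
      using powr_telescope_bounds(1)[of "real (Suc n)" \<delta>] assms
      by (simp add: f_def algebra_simps)
  qed
  then show "zeta_real (1 + \<delta>) \<le> 1 + 1 / \<delta>"
    by simp
qed

text \<open>Euler's sieve: among the surviving terms, the multiples of a new prime p form p^(-s)
  times the whole series, so deleting them multiplies the sum by 1 - p^(-s).\<close>

lemma zeta_sieve: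
  assumes "s > 1" "finite S" "\<And>p. p \<in> S \<Longrightarrow> prime p"
  shows "(\<lambda>n. if \<exists>p\<in>S. p dvd n then 0 else real n powr - s) sums
    (zeta_real s * (\<Prod>p\<in>S. 1 - real p powr - s))"
  using assms(2,3)
proof (induction rule: finite_induct)
  case empty
  then show ?case
    using summable_zeta[OF assms(1)] by (simp add: zeta_real_def summable_sums)
next
  case (insert p S)
  define f where "f = (\<lambda>n. if \<exists>p\<in>S. p dvd n then 0 else real n powr - s)"
  define Z where "Z = zeta_real s * (\<Prod>p\<in>S. 1 - real p powr - s)"
  have f: "f sums Z"
    using insert by (simp add: f_def Z_def)
  have p: "prime p"
    using insert by simp
  have dvd: "q dvd p * m \<longleftrightarrow> q dvd m" if "q \<in> S" for q m
  proof -
    have "prime q" "q \<noteq> p"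
      using insert that by auto
    then show ?thesis
      using p primes_dvd_imp_eq[of q p] by (auto simp: prime_dvd_mult_iff)
  qed
  have "(\<lambda>m. f (p * m)) = (\<lambda>m. real p powr - s * f m)"
    by (auto simp: f_def dvd powr_mult fun_eq_iff)
  then have "(\<lambda>m. (\<lambda>n. if p dvd n then f n else 0) (p * m)) sums (real p powr - s * Z)"
    using sums_mult[OF f] by simp
  then have "(\<lambda>n. if p dvd n then f n else 0) sums (real p powr - s * Z)"
    by (subst (asm) sums_mono_reindex) (use p in \<open>auto intro!: strict_monoI simp: prime_gt_0_nat\<close>)
  from sums_diff[OF f this]
  have "(\<lambda>n. if \<exists>p\<in>insert p S. p dvd n then 0 else real n powr - s) sums (Z - real p powr - s * Z)"
    by (rule sums_cong[THEN iffD1, rotated]) (auto simp: f_def)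
  then show ?case
    using insert by (simp add: Z_def algebra_simps)
qed

text \<open>After sieving by all primes up to N, every fixed n > 1 is eventually deleted, so the
  terms converge to the indicator of n = 1; Tannery's theorem exchanges limit and sum.\<close>

lemma prod_primes_zeta_LIMSEQ:
  assumes "s > 1"
  shows "(\<lambda>N. zeta_real s * (\<Prod>p | p \<le> N \<and> prime p. 1 - real p powr - s)) \<longlonglongrightarrow> 1"
proof -
  define a where "a = (\<lambda>n N. if \<exists>p\<in>{p. p \<le> N \<and> prime p}. p dvd n then 0 else real n powr - s)"
  define b where "b = (\<lambda>n::nat. if n = 1 then 1 else 0 :: real)"
  have "(\<lambda>N. suminf (\<lambda>n. a n N)) \<longlonglongrightarrow> suminf b"
  proof (rule tannerys_theorem[where M = "\<lambda>n. real n powr - s", THEN conjunct2, THEN conjunct2])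
    show "(\<lambda>N. a n N) \<longlonglongrightarrow> b n" for n
    proof (rule tendsto_eventually)
      show "\<forall>\<^sub>F N in sequentially. a n N = b n"
        using eventually_ge_at_top[of n]
      proof eventually_elim
        case (elim N)
        consider "n = 0" | "n = 1" | "n > 1" by linarith
        then show ?case
        proof cases
          case 3
          then obtain p where "prime p" "p dvd n"
            using prime_factor_nat[of n] by auto
          moreover have "p \<le> N"
            using dvd_imp_le[OF \<open>p dvd n\<close>] 3 elim by simp
          ultimately show ?thesis
            using 3 by (auto simp: a_def b_def)
        qed (simp_all add: a_def b_def)
      qed
    qed
    show "\<forall>\<^sub>F (n, N) in at_top \<times>\<^sub>F sequentially. norm (a n N) \<le> real n powr - s"
      by (rule always_eventually) (simp add: a_def split_beta)
  qed (simp_all add: summable_zeta assms)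
  moreover have "suminf b = 1"
    using sums_unique[OF sums_single[of 1 "\<lambda>_. 1 :: real"]] by (simp add: b_def)
  moreover have "suminf (\<lambda>n. a n N) = zeta_real s * (\<Prod>p | p \<le> N \<and> prime p. 1 - real p powr - s)" for N
    unfolding a_def by (rule sums_unique[symmetric], rule zeta_sieve) (use assms in auto)
  ultimately show ?thesis
    by simp
qed

lemma ln_zeta_sums:
  assumes "s > 1"
  shows "(\<lambda>n. if prime n then - ln (1 - real n powr - s) else 0) sums ln (zeta_real s)"
proof -
  have pos: "zeta_real s > 0"
    using zeta_real_bounds(1)[of "s - 1"] assms by (smt (verit) zero_less_divide_1_iff)
  have lt1: "real n powr - s < 1" if "prime n" for n
    using prime_gt_1_nat[OF that] assms by (simp add: powr_less_one)
  have "(\<lambda>N. ln (zeta_real s) - ln (zeta_real s * (\<Prod>p | p \<le> N \<and> prime p. 1 - real p powr - s)))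
      \<longlonglongrightarrow> ln (zeta_real s) - ln 1"
    by (intro tendsto_intros prod_primes_zeta_LIMSEQ assms) simp
  moreover have "ln (zeta_real s) - ln (zeta_real s * (\<Prod>p | p \<le> N \<and> prime p. 1 - real p powr - s)) =
      (\<Sum>n\<le>N. if prime n then - ln (1 - real n powr - s) else 0)" for N
  proof -
    have "(\<Prod>p | p \<le> N \<and> prime p. 1 - real p powr - s) > 0"
      using lt1 by (intro prod_pos) auto
    from ln_mult_pos[OF pos this] have "ln (zeta_real s) - ln (zeta_real s * (\<Prod>p | p \<le> N \<and> prime p. 1 - real p powr - s)) =
        - ln (\<Prod>p | p \<le> N \<and> prime p. 1 - real p powr - s)"
      by simp
    also have "\<dots> = (\<Sum>p | p \<le> N \<and> prime p. - ln (1 - real p powr - s))"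
      using lt1 by (subst ln_prod) (auto simp: sum_negf dest: less_imp_neq)
    also have "\<dots> = (\<Sum>n\<le>N. if prime n then - ln (1 - real n powr - s) else 0)"
      by (rule sum.mono_neutral_cong_left) auto
    finally show ?thesis .
  qed
  ultimately show ?thesis
    by (simp add: sums_def_le)
qed

section \<open>The Laplace transform of the prime weights\<close>

definition mertens_weight :: "nat \<Rightarrow> real" where
  "mertens_weight n = (if prime n then - ln (1 - 1 / real n) else 0)"

text \<open>Both terms equal p^(-1-\<delta>) up to O(p^(-2)). The bound is uniform in \<delta>, as
  dominated convergence for \<delta> tending to 0 requires.\<close>

lemma mertens_weight_diff_bound:
  assumes "\<delta> > 0"
  shows "\<bar>mertens_weight n * exp (- (\<delta> * ln (real n))) -
    (if prime n then - ln (1 - real n powr - (1 + \<delta>)) else 0)\<bar> \<le> 2 * (1 / real n ^ 2)"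
proof (cases "prime n")
  case True
  define x u where "x = 1 / real n" and "u = exp (- (\<delta> * ln (real n)))"
  have n: "n \<ge> 2"
    using True by (rule prime_ge_2_nat)
  then have x: "0 < x" "x \<le> 1 / 2"
    by (auto simp: x_def divide_simps)
  have u: "0 < u" "u \<le> 1"
    using n assms by (auto simp: u_def)
  have "real n powr - (1 + \<delta>) = x * u"
    using n by (simp add: x_def u_def powr_def exp_diff algebra_simps exp_minus divide_simps)
  moreover have "\<bar>- ln (1 - x) * u + ln (1 - x * u)\<bar> \<le> 2 * x\<^sup>2"
  proof -
    have xu: "0 < x * u" "x * u \<le> x"
      using x u by (auto simp: mult_left_le)
    have l: "x \<le> - ln (1 - x)" "- ln (1 - x) \<le> x + 2 * x\<^sup>2"
      using x ln_one_minus_pos_upper_bound[of x] ln_one_minus_pos_lower_bound[of x] by auto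
    have "x * u \<le> - ln (1 - x * u)" "- ln (1 - x * u) \<le> x * u + 2 * (x * u)\<^sup>2"
      using x xu ln_one_minus_pos_upper_bound[of "x * u"] ln_one_minus_pos_lower_bound[of "x * u"] by auto
    moreover have "(x * u)\<^sup>2 \<le> x\<^sup>2"
      using xu by (intro power_mono) auto
    moreover have "x * u \<le> - ln (1 - x) * u" "- ln (1 - x) * u \<le> (x + 2 * x\<^sup>2) * u"
      using l u by (intro mult_right_mono; simp)+
    moreover have "x\<^sup>2 * u \<le> x\<^sup>2"
      using u by (simp add: mult_left_le)
    ultimately show ?thesis
      unfolding distrib_right mult.assoc by linarith
  qed
  ultimately show ?thesis
    using True by (simp add: mertens_weight_def x_def u_def power_one_over)
qed (simp add: mertens_weight_def)

lemma summable_two_over_square: "summable (\<lambda>n. 2 * (1 / real n ^ 2))"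
  using summable_mult[OF inverse_power_summable[of 2, where ?'a = real], of 2] by (simp add: inverse_eq_divide)

lemma mertens_weight_laplace:
  assumes "\<delta> > 0"
  defines "D \<equiv> (\<lambda>n \<delta>. mertens_weight n * exp (- (\<delta> * ln (real n))) -
    (if prime n then - ln (1 - real n powr - (1 + \<delta>)) else 0))"
  shows "(\<lambda>n. mertens_weight n * exp (- (\<delta> * ln (real n)))) sums
    ((\<Sum>n. D n \<delta>) + ln (zeta_real (1 + \<delta>)))"
proof -
  have "summable (\<lambda>n. D n \<delta>)"
    using mertens_weight_diff_bound[OF assms(1)] unfolding D_def
    by (intro summable_comparison_test'[OF summable_two_over_square]) simp
  from sums_add[OF summable_sums[OF this] ln_zeta_sums[of "1 + \<delta>"]] show ?thesis
    using assms(1) by (simp add: D_def)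
qed

text \<open>The transform is ln zeta(1 + \<delta>) plus the series over \<open>D\<close>. Every term
  of that series tends to 0 with \<delta>, hence so does the series by Tannery's theorem, while 1
  \<le> \<delta> zeta(1 + \<delta>) \<le> 1 + \<delta> settles the logarithm.\<close>

interpretation mertens: log_laplace mertens_weight "\<lambda>n. ln (real n)"
proof
  show "mertens_weight n \<ge> 0" for n
    using prime_ge_2_nat[of n] by (auto simp: mertens_weight_def)
  show "ln (real n) \<ge> 0" for n
    by (cases n) auto
  show "summable (\<lambda>n. mertens_weight n * exp (- (\<delta> * ln (real n))))" if "\<delta> > 0" for \<delta>
    using mertens_weight_laplace[OF that] by (rule sums_summable)
  define D where "D = (\<lambda>n \<delta>. mertens_weight n * exp (- (\<delta> * ln (real n))) -
    (if prime n then - ln (1 - real n powr - (1 + \<delta>)) else 0))"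
  have "((\<lambda>\<delta>. \<Sum>n. D n \<delta>) \<longlongrightarrow> (\<Sum>n. 0)) (at_right 0)"
  proof (rule tannerys_theorem[where M = "\<lambda>n. 2 * (1 / real n ^ 2)", THEN conjunct2, THEN conjunct2])
    show "((\<lambda>\<delta>. D n \<delta>) \<longlongrightarrow> 0) (at_right 0)" for n
    proof (cases "prime n")
      case True
      have "n \<ge> 2"
        using True by (rule prime_ge_2_nat)
      then have n: "real n > 0" "1 - real n powr - (1 + 0) \<noteq> 0"
        by (auto simp: powr_minus)
      have "((\<lambda>\<delta>. D n \<delta>) \<longlongrightarrow> mertens_weight n * exp (- (0 * ln (real n))) - (- ln (1 - real n powr - (1 + 0)))) (at_right 0)"
        unfolding D_def if_P[OF True] using n by (intro tendsto_intros) auto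
      then show ?thesis
        using True n by (simp add: mertens_weight_def powr_minus inverse_eq_divide)
    qed (simp add: D_def mertens_weight_def)
    have "\<forall>\<^sub>F x in at_top \<times>\<^sub>F at_right (0::real). 0 < snd x"
      by (rule eventually_compose_filterlim[OF eventually_at_right_less filterlim_snd])
    then show "\<forall>\<^sub>F (n, \<delta>) in at_top \<times>\<^sub>F at_right 0. norm (D n \<delta>) \<le> 2 * (1 / real n ^ 2)"
      by eventually_elim (simp only: split_beta D_def real_norm_def mertens_weight_diff_bound)
  qed (auto simp only: summable_two_over_square trivial_limit_at_right_real)
  moreover have "((\<lambda>\<delta>. ln (\<delta> * zeta_real (1 + \<delta>))) \<longlongrightarrow> ln 1) (at_right 0)"
  proof (intro tendsto_ln)
    show "((\<lambda>\<delta>. \<delta> * zeta_real (1 + \<delta>)) \<longlongrightarrow> 1) (at_right 0)"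
    proof (rule tendsto_sandwich)
      show "\<forall>\<^sub>F \<delta> in at_right 0. 1 \<le> \<delta> * zeta_real (1 + \<delta>)"
        using eventually_at_right_less[of 0]
        by eventually_elim (use zeta_real_bounds(1) in \<open>simp add: field_simps\<close>)
      show "\<forall>\<^sub>F \<delta> in at_right 0. \<delta> * zeta_real (1 + \<delta>) \<le> \<delta> + 1"
        using eventually_at_right_less[of 0]
        by eventually_elim (use zeta_real_bounds(2) in \<open>simp add: field_simps\<close>)
      show "((\<lambda>\<delta>::real. \<delta> + 1) \<longlongrightarrow> 1) (at_right 0)"
        by real_asymp
    qed simp
  qed simp
  ultimately have "((\<lambda>\<delta>. (\<Sum>n. D n \<delta>) + ln (\<delta> * zeta_real (1 + \<delta>))) \<longlongrightarrow> 0) (at_right 0)"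
    using tendsto_add by fastforce
  then show "((\<lambda>\<delta>. (\<Sum>n. mertens_weight n * exp (- (\<delta> * ln (real n)))) + ln \<delta>) \<longlongrightarrow> 0) (at_right 0)"
  proof (rule Lim_transform_eventually)
    show "\<forall>\<^sub>F \<delta> in at_right 0. (\<Sum>n. D n \<delta>) + ln (\<delta> * zeta_real (1 + \<delta>)) =
        (\<Sum>n. mertens_weight n * exp (- (\<delta> * ln (real n)))) + ln \<delta>"
      using eventually_at_right_less[of 0]
    proof eventually_elim
      case (elim \<delta>)
      have "zeta_real (1 + \<delta>) > 0"
        using zeta_real_bounds(1)[OF elim] elim by (smt (verit) zero_less_divide_1_iff)
      then show ?case
        using elim mertens_weight_laplace[OF elim] by (simp add: D_def sums_iff ln_mult)
    qed
  qed
qed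

section \<open>Evaluating both families at the step function\<close>

lemma mertens_wsum_step:
  assumes "y \<ge> 2"
  shows "mertens.wsum step (1 / ln (real y)) = (\<Sum>n\<le>y. mertens_weight n)"
proof -
  have step: "mertens_weight n * step (exp (- (1 / ln (real y) * ln (real n)))) = (if n \<le> y then mertens_weight n else 0)" for n
  proof (cases "prime n")
    case True
    then have "n \<ge> 2"
      by (rule prime_ge_2_nat)
    then have "exp (- (1 / ln (real y) * ln (real n))) < exp (- 1) \<longleftrightarrow> y < n"
      using assms by (simp add: divide_simps)
    then show ?thesis
      by (auto simp: step_def)
  qed (simp add: mertens_weight_def)
  have "mertens.wsum step (1 / ln (real y)) = (\<Sum>n\<le>y. if n \<le> y then mertens_weight n else 0)"
    unfolding mertens.wsum_def step by (rule suminf_finite) auto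
  then show ?thesis
    by simp
qed

lemma harmonic_wsum_step:
  assumes "X > 0"
  shows "harmonic.wsum step (1 / X) = harm (nat \<lfloor>X\<rfloor>)"
proof -
  have step: "1 / real n * step (exp (- (1 / X * real n))) = (if n \<in> {1..nat \<lfloor>X\<rfloor>} then 1 / real n else 0)" for n
  proof (cases "n = 0")
    case False
    have "exp (- (1 / X * real n)) < exp (- 1) \<longleftrightarrow> X < real n"
      using assms by (simp add: divide_simps)
    moreover have "real n \<le> X \<longleftrightarrow> n \<le> nat \<lfloor>X\<rfloor>"
      using assms by (simp add: le_nat_floor le_nat_iff le_floor_iff)
    ultimately show ?thesis
      using False by (auto simp: step_def)
  qed auto
  have "harmonic.wsum step (1 / X) = (\<Sum>n\<in>{1..nat \<lfloor>X\<rfloor>}. if n \<in> {1..nat \<lfloor>X\<rfloor>} then 1 / real n else 0)"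
    unfolding harmonic.wsum_def step by (rule suminf_finite) auto
  then show ?thesis
    by (simp add: harm_def inverse_eq_divide)
qed

text \<open>At \<delta> = 1 / ln y the cut-offs are p \<le> y for the primes and k \<le> ln y for
  the harmonic weights. So the sum of - ln (1 - 1/p) is the harmonic number at the floor of ln y up
  to o(1), that is ln (ln y) + \<gamma> + o(1).\<close>

theorem mertens_third:
  "(\<lambda>y. (\<Prod>n\<le>y. if prime n then 1 - 1 / real n else 1) * ln (real y)) \<longlonglongrightarrow> exp (- euler_mascheroni)"
proof -
  have "filterlim (\<lambda>y::nat. 1 / ln (real y)) (at_right 0) sequentially"
    by real_asymp
  from filterlim_compose[OF mertens.wsum_step_harmonic this]
  have 1: "(\<lambda>y. mertens.wsum step (1 / ln (real y)) - harmonic.wsum step (1 / ln (real y))) \<longlonglongrightarrow> 0" .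
  have "filterlim (\<lambda>y::nat. nat \<lfloor>ln (real y)\<rfloor>) at_top sequentially"
    by real_asymp
  from filterlim_compose[OF euler_mascheroni_LIMSEQ this]
  have 2: "(\<lambda>y. harm (nat \<lfloor>ln (real y)\<rfloor>) - ln (real (nat \<lfloor>ln (real y)\<rfloor>))) \<longlonglongrightarrow> (euler_mascheroni :: real)" .
  have 3: "(\<lambda>y. ln (real (nat \<lfloor>ln (real y)\<rfloor>)) - ln (ln (real y))) \<longlonglongrightarrow> 0"
    by real_asymp
  have lim: "(\<lambda>y. exp (- ((mertens.wsum step (1 / ln (real y)) - harmonic.wsum step (1 / ln (real y))) +
      (harm (nat \<lfloor>ln (real y)\<rfloor>) - ln (real (nat \<lfloor>ln (real y)\<rfloor>))) +
      (ln (real (nat \<lfloor>ln (real y)\<rfloor>)) - ln (ln (real y)))))) \<longlonglongrightarrow> exp (- (0 + euler_mascheroni + 0))"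
    by (intro tendsto_intros 1 2 3)
  have ev: "\<forall>\<^sub>F y in sequentially. exp (- ((mertens.wsum step (1 / ln (real y)) - harmonic.wsum step (1 / ln (real y))) +
      (harm (nat \<lfloor>ln (real y)\<rfloor>) - ln (real (nat \<lfloor>ln (real y)\<rfloor>))) +
      (ln (real (nat \<lfloor>ln (real y)\<rfloor>)) - ln (ln (real y))))) =
      (\<Prod>n\<le>y. if prime n then 1 - 1 / real n else 1) * ln (real y)"
    using eventually_ge_at_top[of 2]
  proof eventually_elim
    case (elim y)
    then have pos: "ln (real y) > 0"
      by simp
    have "exp (- mertens_weight n) = (if prime n then 1 - 1 / real n else 1)" for n
      using prime_gt_1_nat[of n] by (auto simp: mertens_weight_def)
    then have "exp (- (\<Sum>n\<le>y. mertens_weight n)) = (\<Prod>n\<le>y. if prime n then 1 - 1 / real n else 1)"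
      by (simp add: exp_sum flip: sum_negf)
    then show ?case
      using pos by (simp add: mertens_wsum_step[OF elim] harmonic_wsum_step[OF pos] exp_diff exp_minus divide_simps)
  qed
  from Lim_transform_eventually[OF lim ev] show ?thesis
    by simp
qed

section \<open>The function \<open>\<phi>\<^sub>A\<close> and the lower bound\<close>

locale phi_system =
  fixes A :: "nat \<Rightarrow> nat set" and \<phi> :: "nat \<Rightarrow> real"
  assumes divisor_system: "divisor_system A"
    and multiplicative_system: "multiplicative_system A"
    and self_mem: "n \<ge> 1 \<Longrightarrow> n \<in> A n"
    and is_phi: "is_phi A \<phi>"
begin

lemma A_dvd: "n \<ge> 1 \<Longrightarrow> d \<in> A n \<Longrightarrow> d dvd n"
  using divisor_system by (auto simp: divisor_system_def)

lemma A_pos: "n \<ge> 1 \<Longrightarrow> d \<in> A n \<Longrightarrow> d \<ge> 1"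
  using A_dvd[of n d] by (cases d) auto

lemma finite_A: "n \<ge> 1 \<Longrightarrow> finite (A n)"
  by (rule finite_subset[of _ "{d. d dvd n}"]) (use A_dvd in auto)

lemma sum_phi: "n \<ge> 1 \<Longrightarrow> (\<Sum>d\<in>A n. \<phi> d) = real n"
  using is_phi by (simp add: is_phi_def)

lemma phi_one: "\<phi> 1 = 1"
proof -
  have "A 1 = {1}"
    using A_dvd[of 1] self_mem[of 1] by auto
  then show ?thesis
    using sum_phi[of 1] by simp
qed

text \<open>Coprimality makes A m \<times> A n a unique parametrisation of A (m n). Expanding m n
  once by the defining equation and once as a product of two such sums, all terms except the one at
  (m, n) agree by induction.\<close>

lemma phi_mult:
  assumes "coprime m n" "m \<ge> 1" "n \<ge> 1"
  shows "\<phi> (m * n) = \<phi> m * \<phi> n"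
  using assms
proof (induction "m * n" arbitrary: m n rule: less_induct)
  case less
  have A_mn: "A (m * n) = (\<lambda>(a, b). a * b) ` (A m \<times> A n)"
    using multiplicative_system less.prems unfolding multiplicative_system_def by (auto simp: image_iff)
  have inj: "inj_on (\<lambda>(a, b). a * b) (A m \<times> A n)"
  proof (rule inj_onI, clarify)
    fix a b c d assume *: "a \<in> A m" "b \<in> A n" "c \<in> A m" "d \<in> A n" "a * b = c * d"
    have "coprime a d" "coprime c b"
      using less.prems * A_dvd by (meson coprime_divisors)+
    have "a dvd c * d" "c dvd a * b"
      using * by (metis dvd_triv_left)+
    then have "a dvd c" "c dvd a"
      using \<open>coprime a d\<close> \<open>coprime c b\<close> by (simp_all add: coprime_dvd_mult_left_iff)
    then have "a = c"
      by (rule dvd_antisym)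
    then show "a = c \<and> b = d"
      using * A_pos[of m c] less.prems by auto
  qed
  have fin: "finite (A m \<times> A n)"
    using less.prems by (simp add: finite_A)
  have mem: "(m, n) \<in> A m \<times> A n"
    using less.prems by (simp add: self_mem)
  have IH: "\<phi> (a * b) = \<phi> a * \<phi> b" if ab: "(a, b) \<in> A m \<times> A n - {(m, n)}" for a b
  proof (rule less.hyps)
    have d: "a dvd m" "b dvd n" "a \<ge> 1" "b \<ge> 1"
      using ab less.prems A_dvd A_pos by auto
    then have "a \<le> m" "b \<le> n"
      using less.prems by (auto intro: dvd_imp_le)
    moreover have "a \<noteq> m \<or> b \<noteq> n"
      using ab by auto
    ultimately show "a * b < m * n"
      using d less.prems \<open>a \<le> m\<close> \<open>b \<le> n\<close>
      mult_less_le_imp_less[of a m b n] mult_le_less_imp_less[of a m b n] by (auto simp: less_le)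
    show "coprime a b"
      using d less.prems by (meson coprime_divisors)
  qed (use ab less.prems A_pos in auto)
  have "real (m * n) = (\<Sum>(a, b)\<in>A m \<times> A n. \<phi> (a * b))"
  proof -
    have "(\<Sum>d\<in>A (m * n). \<phi> d) = (\<Sum>(a, b)\<in>A m \<times> A n. \<phi> (a * b))"
      unfolding A_mn by (subst sum.reindex[OF inj]) (simp add: split_beta)
    then show ?thesis
      using sum_phi[of "m * n"] less.prems by simp
  qed
  also have "\<dots> = \<phi> (m * n) + (\<Sum>(a, b)\<in>A m \<times> A n - {(m, n)}. \<phi> (a * b))"
    using sum.remove[OF fin mem, of "\<lambda>(a, b). \<phi> (a * b)"] by simp
  also have "(\<Sum>(a, b)\<in>A m \<times> A n - {(m, n)}. \<phi> (a * b)) = (\<Sum>(a, b)\<in>A m \<times> A n - {(m, n)}. \<phi> a * \<phi> b)"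
    using IH by (intro sum.cong) auto
  finally have 1: "real (m * n) = \<phi> (m * n) + (\<Sum>(a, b)\<in>A m \<times> A n - {(m, n)}. \<phi> a * \<phi> b)" .
  have "real (m * n) = (\<Sum>a\<in>A m. \<phi> a) * (\<Sum>b\<in>A n. \<phi> b)"
    using less.prems by (simp add: sum_phi)
  also have "\<dots> = (\<Sum>(a, b)\<in>A m \<times> A n. \<phi> a * \<phi> b)"
    by (simp add: sum_product sum.cartesian_product)
  also have "\<dots> = \<phi> m * \<phi> n + (\<Sum>(a, b)\<in>A m \<times> A n - {(m, n)}. \<phi> a * \<phi> b)"
    using sum.remove[OF fin mem, of "\<lambda>(a, b). \<phi> a * \<phi> b"] by simp
  finally show ?case
    using 1 by simp
qed

lemma phi_prod_prime_powers:
  assumes "finite S" "\<And>p. p \<in> S \<Longrightarrow> prime p"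
  shows "\<phi> (\<Prod>p\<in>S. p ^ k p) = (\<Prod>p\<in>S. \<phi> (p ^ k p))"
  using assms
proof (induction rule: finite_induct)
  case (insert p S)
  have "coprime (p ^ k p) (\<Prod>q\<in>S. q ^ k q)"
  proof (rule prod_coprime_right)
    fix q assume "q \<in> S"
    then have "coprime p q"
      using insert by (intro primes_coprime) auto
    then show "coprime (p ^ k p) (q ^ k q)"
      by simp
  qed
  moreover have "(\<Prod>q\<in>S. q ^ k q) > 0" "p ^ k p > 0"
    using insert.prems by (auto intro!: prod_pos simp: prime_gt_0_nat)
  ultimately have "\<phi> (p ^ k p * (\<Prod>q\<in>S. q ^ k q)) = \<phi> (p ^ k p) * \<phi> (\<Prod>q\<in>S. q ^ k q)"
    by (intro phi_mult) linarith+
  then show ?case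
    using insert by simp
qed (use phi_one in simp)

section \<open>Bounds at prime powers\<close>

definition ratio :: "nat \<Rightarrow> nat \<Rightarrow> real" where
  "ratio p \<nu> = \<phi> (p ^ \<nu>) / real (p ^ \<nu>)"

lemma phi_ratio_prod:
  assumes "finite S" "\<And>p. p \<in> S \<Longrightarrow> prime p"
  shows "\<phi> (\<Prod>p\<in>S. p ^ k p) / real (\<Prod>p\<in>S. p ^ k p) = (\<Prod>p\<in>S. ratio p (k p))"
  by (simp add: phi_prod_prime_powers[OF assms] ratio_def prod_dividef)

lemma A_prime_power_strict:
  assumes "prime p"
  shows "{d \<in> A (p ^ \<nu>). d < p ^ \<nu>} \<subseteq> (\<lambda>j. p ^ j) ` {..<\<nu>}"
proof
  fix d assume d: "d \<in> {d \<in> A (p ^ \<nu>). d < p ^ \<nu>}"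
  then have "d dvd p ^ \<nu>"
    using assms by (intro A_dvd) (auto simp: Suc_le_eq prime_gt_0_nat)
  then obtain j where j: "j \<le> \<nu>" "d = p ^ j"
    using divides_primepow_nat[OF assms] by auto
  then show "d \<in> (\<lambda>j. p ^ j) ` {..<\<nu>}"
    using d by (cases "j = \<nu>") auto
qed

lemma phi_prime_power_split:
  assumes "prime p"
  shows "\<phi> (p ^ \<nu>) = real (p ^ \<nu>) - (\<Sum>d | d \<in> A (p ^ \<nu>) \<and> d < p ^ \<nu>. \<phi> d)"
proof -
  have "p ^ \<nu> \<ge> 1"
    using assms by (simp add: Suc_le_eq prime_gt_0_nat)
  then show ?thesis
    using divisor_system_sum_split[OF divisor_system self_mem, of "p ^ \<nu>" \<phi>] sum_phi[of "p ^ \<nu>"] by simp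
qed

text \<open>The recursion subtracts at most all earlier values, which are at most p^j and add up to
  a geometric sum below p^\<nu>. The three bounds are proved together because each step uses
  positivity and the upper bound of the earlier values.\<close>

lemma phi_prime_power_bounds:
  assumes "prime p"
  shows "real (p ^ \<nu>) - (real (p ^ \<nu>) - 1) / (real p - 1) \<le> \<phi> (p ^ \<nu>)
    \<and> 0 < \<phi> (p ^ \<nu>) \<and> \<phi> (p ^ \<nu>) \<le> real (p ^ \<nu>)"
proof (induction \<nu> rule: less_induct)
  case (less \<nu>)
  have p: "real p \<ge> 2"
    using prime_ge_2_nat[OF assms] by simp
  let ?S = "{d. d \<in> A (p ^ \<nu>) \<and> d < p ^ \<nu>}"
  have nonneg: "\<phi> d \<ge> 0" if "d \<in> ?S" for d
  proof -
    obtain j where "j < \<nu>" "d = p ^ j"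
      using subsetD[OF A_prime_power_strict[OF assms] \<open>d \<in> ?S\<close>] by blast
    then show ?thesis
      using less[of j] by simp
  qed
  have "(\<Sum>d\<in>?S. \<phi> d) \<le> (\<Sum>d\<in>(\<lambda>j. p ^ j) ` {..<\<nu>}. \<phi> d)"
    using A_prime_power_strict[OF assms, of \<nu>] less by (intro sum_mono2) (auto simp: less_imp_le)
  also have "\<dots> = (\<Sum>j<\<nu>. \<phi> (p ^ j))"
    by (subst sum.reindex) (use prime_gt_1_nat[OF assms] in \<open>auto intro!: inj_onI\<close>)
  also have "\<dots> \<le> (\<Sum>j<\<nu>. real p ^ j)"
    using less by (intro sum_mono) auto
  also have "\<dots> = (real (p ^ \<nu>) - 1) / (real p - 1)"
    using p by (subst geometric_sum) auto
  finally have 1: "(\<Sum>d\<in>?S. \<phi> d) \<le> (real (p ^ \<nu>) - 1) / (real p - 1)" .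
  have "real (p ^ \<nu>) \<ge> 1"
    using p by simp
  then have "(real (p ^ \<nu>) - 1) / (real p - 1) \<le> (real (p ^ \<nu>) - 1) / 1"
    using p by (intro divide_left_mono) auto
  moreover have "(\<Sum>d\<in>?S. \<phi> d) \<ge> 0"
    using nonneg by (rule sum_nonneg)
  ultimately show ?case
    using 1 by (simp add: phi_prime_power_split[OF assms, of \<nu>])
qed

lemma ratio_pos: "prime p \<Longrightarrow> ratio p \<nu> > 0"
  using phi_prime_power_bounds[of p \<nu>] by (simp add: ratio_def prime_gt_0_nat)

lemma ratio_ge:
  assumes "prime p"
  shows "ratio p \<nu> \<ge> 1 - 1 / (real p - 1)"
proof -
  have p: "real p \<ge> 2"
    using prime_ge_2_nat[OF assms] by simp
  have "real (p ^ \<nu>) * (1 - 1 / (real p - 1)) \<le> real (p ^ \<nu>) - (real (p ^ \<nu>) - 1) / (real p - 1)"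
    using p by (simp add: divide_simps) (simp add: algebra_simps)
  also have "\<dots> \<le> \<phi> (p ^ \<nu>)"
    using phi_prime_power_bounds[OF assms] by simp
  finally show ?thesis
    using p by (simp add: ratio_def field_simps)
qed

text \<open>Membership of p^(e-1) forces \<phi>(p^e) \<le> p^e - \<phi>(p^(e-1)), and
  \<open>ratio_ge\<close> bounds the subtracted term from below. The result is written as the
  Mertens factor times a second-order correction.\<close>

lemma ratio_le_of_mem:
  assumes "prime p" "p > 2" "e \<ge> 1" "p ^ (e - 1) \<in> A (p ^ e)"
  shows "ratio p e \<le> (1 - 1 / real p) * (1 + 1 / (real p - 1)\<^sup>2)"
proof -
  have p: "real p > 2"
    using assms by simp
  let ?S = "{d. d \<in> A (p ^ e) \<and> d < p ^ e}"
  obtain k where k: "e = Suc k"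
    using assms(3) by (cases e) auto
  have "\<phi> (p ^ k) \<le> (\<Sum>d\<in>?S. \<phi> d)"
  proof (rule member_le_sum)
    show "p ^ k \<in> ?S"
      using assms by (simp add: k)
    show "0 \<le> \<phi> d" if "d \<in> ?S - {p ^ k}" for d
    proof -
      obtain j where "d = p ^ j"
        using subsetD[OF A_prime_power_strict[OF assms(1)], of d e] \<open>d \<in> ?S - {p ^ k}\<close> by blast
      then show ?thesis
        using phi_prime_power_bounds[OF assms(1), of j] by simp
    qed
    show "finite ?S"
      by simp
  qed
  then have "\<phi> (p ^ e) \<le> real (p ^ e) - \<phi> (p ^ k)"
    by (simp add: phi_prime_power_split[OF assms(1), of e])
  then have "ratio p e \<le> (real (p ^ e) - \<phi> (p ^ k)) / real (p ^ e)"
    unfolding ratio_def by (intro divide_right_mono) auto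
  also have "\<dots> = 1 - ratio p k / real p"
    using p by (simp add: ratio_def k divide_simps)
  also have "\<dots> \<le> 1 - (1 - 1 / (real p - 1)) / real p"
    using p by (intro diff_left_mono divide_right_mono ratio_ge assms) auto
  also have "\<dots> = (1 - 1 / real p) * (1 + 1 / (real p - 1)\<^sup>2)"
    using p by (simp add: divide_simps power2_eq_square) (simp add: algebra_simps)
  finally show ?thesis .
qed

definition inf_ratio :: "nat \<Rightarrow> real" where
  "inf_ratio p = (INF \<nu>. ratio p \<nu>)"

lemma bdd_below_ratio: "prime p \<Longrightarrow> bdd_below (range (ratio p))"
  using ratio_pos by (intro bdd_belowI[of _ 0]) (auto intro: less_imp_le)

lemma inf_ratio_le: "prime p \<Longrightarrow> inf_ratio p \<le> ratio p \<nu>"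
  unfolding inf_ratio_def by (intro cINF_lower bdd_below_ratio) auto

lemma inf_ratio_nonneg: "prime p \<Longrightarrow> 0 \<le> inf_ratio p"
  unfolding inf_ratio_def using ratio_pos by (intro cINF_greatest) (auto intro: less_imp_le)

lemma inf_ratio_le_one: "prime p \<Longrightarrow> inf_ratio p \<le> 1"
  using inf_ratio_le[of p 0] phi_one by (simp add: ratio_def)

lemma inf_ratio_ge: "prime p \<Longrightarrow> 1 - 1 / (real p - 1) \<le> inf_ratio p"
  unfolding inf_ratio_def using ratio_ge by (intro cINF_greatest) auto

lemma local_factor_eq: "local_factor \<phi> p = inf_ratio p / (1 - 1 / real p)"
  by (simp add: local_factor_def inf_ratio_def ratio_def divide_inverse)

text \<open>One half of the estimate that keeps the factor within 1/(p-1)^2 of 1. At p = 2 the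
  underlying bound \<open>ratio_ge\<close> degenerates to 0, which leaves room for a vanishing
  factor.\<close>

lemma local_factor_ge:
  assumes "prime p" "p > 2"
  shows "local_factor \<phi> p \<ge> 1 - 1 / (real p - 1)\<^sup>2"
proof -
  have p: "real p > 2"
    using assms by simp
  have "1 - 1 / (real p - 1)\<^sup>2 = (1 - 1 / (real p - 1)) / (1 - 1 / real p)"
    using p by (simp add: divide_simps power2_eq_square) (simp add: algebra_simps)
  also have "\<dots> \<le> local_factor \<phi> p"
    unfolding local_factor_eq using p by (intro divide_right_mono inf_ratio_ge assms) auto
  finally show ?thesis .
qed

section \<open>A lower bound for \<open>\<phi> n / n\<close> by splitting the prime factors of
  n\<close>

definition inf_prod :: "nat \<Rightarrow> real" where
  "inf_prod y = (\<Prod>n\<le>y. if prime n then inf_ratio n else 1)"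

lemma inf_prod_eq:
  "inf_prod y = (\<Prod>n\<le>y. if prime n then 1 - 1 / real n else 1) * (\<Prod>n\<le>y. if prime n then local_factor \<phi> n else 1)"
proof -
  have "(if prime n then 1 - 1 / real n else 1) * (if prime n then local_factor \<phi> n else 1) =
      (if prime n then inf_ratio n else 1)" for n
    using prime_gt_1_nat[of n] by (auto simp: local_factor_eq)
  then show ?thesis
    by (simp add: inf_prod_def flip: prod.distrib)
qed

lemma phi_ratio_eq:
  assumes "n \<ge> 1"
  shows "\<phi> n / real n = (\<Prod>p\<in>prime_factors n. ratio p (multiplicity p n))"
  using phi_ratio_prod[of "prime_factors n" "\<lambda>p. multiplicity p n"] prod_prime_factors[of n] assms
  by (simp add: in_prime_factors_imp_prime)

text \<open>The distinct prime factors above y are each at least y + 1 and multiply to at most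
  n.\<close>

lemma large_prime_factors_le:
  assumes "n \<ge> 1"
  shows "real (card {p \<in> prime_factors n. y < p}) * ln (real y + 1) \<le> ln (real n)"
proof -
  let ?P = "{p \<in> prime_factors n. y < p}"
  have "real (card ?P) * ln (real y + 1) = (\<Sum>p\<in>?P. ln (real y + 1))"
    by simp
  also have "\<dots> \<le> (\<Sum>p\<in>?P. ln (real p))"
    by (intro sum_mono) auto
  also have "\<dots> = ln (real (\<Prod>p\<in>?P. p))"
  proof -
    have "real p > 0" if "p \<in> ?P" for p
      using that by (auto dest: in_prime_factors_imp_prime prime_gt_0_nat)
    then show ?thesis
      by (subst of_nat_prod, subst ln_prod) auto
  qed
  also have "(\<Prod>p\<in>?P. p) \<le> n"
  proof -
    have "(\<Prod>p\<in>?P. p) \<le> (\<Prod>p\<in>?P. p ^ multiplicity p n)"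
      by (intro prod_mono) (auto simp: in_prime_factors_iff prime_factors_multiplicity intro!: self_le_power dest: prime_gt_0_nat)
    also have "\<dots> \<le> (\<Prod>p\<in>prime_factors n. p ^ multiplicity p n)"
      by (intro dvd_imp_le prod_dvd_prod_subset prod_pos) (auto simp: in_prime_factors_iff prime_gt_0_nat)
    also have "\<dots> = n"
      using prod_prime_factors[of n] assms by simp
    finally show ?thesis .
  qed
  then have "ln (real (\<Prod>p\<in>?P. p)) \<le> ln (real n)"
    using assms by (subst ln_le_cancel_iff) (auto intro!: prod_pos simp: in_prime_factors_iff prime_gt_0_nat simp flip: of_nat_prod)
  finally show ?thesis .
qed

text \<open>Prime factors up to y contribute at least \<open>inf_prod y\<close>, since the factors
  of absent primes are at most 1. Those above y number at most (y+1) / ln (y+1) and contribute at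
  least 1 - 1/y each, so Bernoulli's inequality bounds their product.\<close>

lemma phi_ratio_lower:
  assumes "n \<ge> 1" "y \<ge> 2" "ln (real n) \<le> real y + 1"
  shows "inf_prod y * (1 - (real y + 1) / (real y * ln (real y + 1))) \<le> \<phi> n / real n"
proof -
  define S T where "S = {p \<in> prime_factors n. p \<le> y}" and "T = {p \<in> prime_factors n. y < p}"
  have split: "prime_factors n = S \<union> T" "S \<inter> T = {}" "finite S" "finite T"
    by (auto simp: S_def T_def)
  have prime: "prime p" if "p \<in> S \<union> T" for p
    using that by (auto simp: S_def T_def)
  have m: "0 \<le> inf_ratio p" "inf_ratio p \<le> 1" if "p \<in> S \<union> T" for p
    using prime[OF that] inf_ratio_nonneg inf_ratio_le_one by auto
  have "(\<Prod>p\<in>S \<union> T. inf_ratio p) \<le> (\<Prod>p\<in>S \<union> T. ratio p (multiplicity p n))"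
    using m prime by (intro prod_mono) (auto intro: inf_ratio_le)
  then have 1: "(\<Prod>p\<in>S. inf_ratio p) * (\<Prod>p\<in>T. inf_ratio p) \<le> \<phi> n / real n"
    using split by (simp add: phi_ratio_eq[OF assms(1)] prod.union_disjoint)
  have "inf_prod y = (\<Prod>p | p \<le> y \<and> prime p. inf_ratio p)"
    unfolding inf_prod_def by (rule prod.mono_neutral_cong_right) auto
  also have "\<dots> = (\<Prod>p\<in>S. inf_ratio p) * (\<Prod>p\<in>{p. p \<le> y \<and> prime p} - S. inf_ratio p)"
    by (subst prod.subset_diff[of S]) (auto simp: S_def mult.commute)
  also have "\<dots> \<le> (\<Prod>p\<in>S. inf_ratio p) * 1"
    using m by (intro mult_left_mono prod_le_1 prod_nonneg) (auto intro: inf_ratio_nonneg inf_ratio_le_one)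
  finally have 2: "inf_prod y \<le> (\<Prod>p\<in>S. inf_ratio p)"
    by simp
  have "real (card T) \<le> (real y + 1) / ln (real y + 1)"
    using large_prime_factors_le[OF assms(1), of y] assms(2,3) by (simp add: T_def pos_le_divide_eq)
  then have "real (card T) / real y \<le> (real y + 1) / ln (real y + 1) / real y"
    by (rule divide_right_mono) simp
  then have "1 - (real y + 1) / (real y * ln (real y + 1)) \<le> 1 + real (card T) * (- (1 / real y))"
    by (simp add: mult.commute)
  also have "\<dots> \<le> (1 + - (1 / real y)) ^ card T"
    using assms(2) by (intro Bernoulli_inequality) (simp add: divide_simps)
  also have "\<dots> = (\<Prod>p\<in>T. 1 - 1 / real y)"
    by simp
  also have "\<dots> \<le> (\<Prod>p\<in>T. inf_ratio p)"
  proof (intro prod_mono conjI)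
    fix p assume p: "p \<in> T"
    then have "real y \<le> real p - 1"
      by (auto simp: T_def)
    then have "1 / (real p - 1) \<le> 1 / real y"
      using assms(2) by (intro divide_left_mono) auto
    then show "1 - 1 / real y \<le> inf_ratio p"
      using inf_ratio_ge[of p] prime[of p] p by auto
  qed (use assms(2) in auto)
  finally have 3: "1 - (real y + 1) / (real y * ln (real y + 1)) \<le> (\<Prod>p\<in>T. inf_ratio p)" .
  have "0 \<le> inf_prod y"
    unfolding inf_prod_def by (intro prod_nonneg) (auto intro: inf_ratio_nonneg)
  then have "inf_prod y * (1 - (real y + 1) / (real y * ln (real y + 1))) \<le> inf_prod y * (\<Prod>p\<in>T. inf_ratio p)"
    using 3 by (rule mult_left_mono[rotated])
  also have "\<dots> \<le> (\<Prod>p\<in>S. inf_ratio p) * (\<Prod>p\<in>T. inf_ratio p)"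
    using 2 m by (intro mult_right_mono prod_nonneg) auto
  finally show ?thesis
    using 1 by linarith
qed

end

section \<open>The limes inferior\<close>

lemma Liminf_le_along:
  assumes "filterlim g at_top sequentially" "\<forall>\<^sub>F y in sequentially. f (g y) \<le> b y" "b \<longlonglongrightarrow> l"
  shows "Liminf sequentially (\<lambda>n. ereal (f n)) \<le> ereal l"
proof (rule ccontr)
  assume "\<not> Liminf sequentially (\<lambda>n. ereal (f n)) \<le> ereal l"
  then obtain c where c: "ereal l < ereal c" "ereal c < Liminf sequentially (\<lambda>n. ereal (f n))"
    using ereal_dense2[of "ereal l"] by (auto simp: not_le)
  have "\<forall>\<^sub>F y in sequentially. c < f (g y)"
    using eventually_compose_filterlim[OF less_LiminfD[OF c(2)] assms(1)] by simp
  moreover have "\<forall>\<^sub>F y in sequentially. b y < c"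
    using c(1) assms(3) by (intro order_tendstoD(2)) auto
  ultimately have "\<forall>\<^sub>F y in sequentially. False"
    using assms(2) by eventually_elim linarith
  then show False
    by simp
qed

lemma le_ereal_LIMSEQ:
  assumes "x \<longlonglongrightarrow> l" "\<forall>\<^sub>F j in sequentially. X \<le> ereal (x j)"
  shows "X \<le> ereal l"
  using tendsto_lowerbound[OF tendsto_ereal[OF assms(1)] assms(2)] by simp

lemma subpolynomial_on_primesD:
  assumes "subpolynomial_on_primes e" "\<delta> > 0"
  shows "\<exists>P. \<forall>p\<ge>P. prime p \<longrightarrow> real (e p) \<le> real p powr \<delta>"
proof -
  obtain h where h: "(h \<longlongrightarrow> 0) primes_at_top" "\<forall>\<^sub>F p in primes_at_top. real (e p) = real p powr h p"
    using assms(1) by (auto simp: subpolynomial_on_primes_def)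
  have "\<forall>\<^sub>F p in primes_at_top. h p < \<delta>"
    using h(1) assms(2) by (rule order_tendstoD(2))
  with h(2) have "\<forall>\<^sub>F p in primes_at_top. real (e p) = real p powr h p \<and> h p < \<delta>"
    by eventually_elim auto
  then obtain P where "\<forall>p\<ge>P. prime p \<longrightarrow> real (e p) = real p powr h p \<and> h p < \<delta>"
    by (auto simp: primes_at_top_def eventually_inf_principal eventually_at_top_linorder)
  then show ?thesis
    by (intro exI[of _ P]) (auto intro!: powr_mono simp: Suc_le_eq prime_gt_0_nat)
qed

text \<open>Combines 1 + x \<le> exp x with the telescoping bound 1/m^2 \<le> 1/(m-1) - 1/m; the
  term - 1/(y-1) is kept only for the induction.\<close>

lemma prod_one_plus_inverse_square_le:
  assumes "k \<ge> 2" "k \<le> y"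
  shows "(\<Prod>n\<in>{k<..y}. 1 + 1 / (real n - 1)\<^sup>2) \<le> exp (1 / (real k - 1) - 1 / (real y - 1))"
  using assms(2)
proof (induction y rule: dec_induct)
  case (step y)
  have y: "real y > 1"
    using step assms by simp
  have "1 + 1 / (real (Suc y) - 1)\<^sup>2 \<le> exp (1 / (real (Suc y) - 1)\<^sup>2)"
    by simp
  also have "1 / (real (Suc y) - 1)\<^sup>2 \<le> 1 / (real y - 1) - 1 / (real (Suc y) - 1)"
    using y by (simp add: divide_simps power2_eq_square)
  finally have 1: "1 + 1 / (real (Suc y) - 1)\<^sup>2 \<le> exp (1 / (real y - 1) - 1 / (real (Suc y) - 1))"
    by simp
  have "{k<..Suc y} = insert (Suc y) {k<..y}"
    using step by auto
  then have "(\<Prod>n\<in>{k<..Suc y}. 1 + 1 / (real n - 1)\<^sup>2) =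
      (1 + 1 / (real (Suc y) - 1)\<^sup>2) * (\<Prod>n\<in>{k<..y}. 1 + 1 / (real n - 1)\<^sup>2)"
    by simp
  also have "\<dots> \<le> exp (1 / (real y - 1) - 1 / (real (Suc y) - 1)) * exp (1 / (real k - 1) - 1 / (real y - 1))"
    using 1 step by (intro mult_mono prod_nonneg) auto
  also have "\<dots> = exp (1 / (real k - 1) - 1 / (real (Suc y) - 1))"
    by (simp flip: exp_add)
  finally show ?case .
qed simp

section \<open>Local factors under the exponent condition\<close>

locale phi_system_exponents = phi_system +
  fixes e :: "nat \<Rightarrow> nat"
  assumes e_ge_1: "prime p \<Longrightarrow> p > 2 \<Longrightarrow> e p \<ge> 1"
    and e_mem: "prime p \<Longrightarrow> p > 2 \<Longrightarrow> p ^ (e p - 1) \<in> A (p ^ e p)"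
    and e_subpolynomial: "subpolynomial_on_primes e"
begin

lemma ratio_e_le: "prime p \<Longrightarrow> p > 2 \<Longrightarrow> ratio p (e p) \<le> (1 - 1 / real p) * (1 + 1 / (real p - 1)\<^sup>2)"
  by (intro ratio_le_of_mem e_ge_1 e_mem)

lemma local_factor_le:
  assumes "prime p" "p > 2"
  shows "local_factor \<phi> p \<le> 1 + 1 / (real p - 1)\<^sup>2"
proof -
  have "1 - 1 / real p > 0"
    using assms by simp
  moreover have "inf_ratio p \<le> (1 - 1 / real p) * (1 + 1 / (real p - 1)\<^sup>2)"
    using inf_ratio_le[OF assms(1), of "e p"] ratio_e_le[OF assms] by linarith
  ultimately show ?thesis
    by (simp add: local_factor_eq pos_divide_le_eq mult.commute)
qed

text \<open>The predicate leaves the prime 2 open, so one proof serves the full product and the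
  product over p > 2. A zero factor at 2 does no harm, as \<open>convergent_prod\<close> admits
  finitely many zeros.\<close>

lemma convergent_prod_local_factor:
  assumes "\<And>p. prime p \<Longrightarrow> p > 2 \<Longrightarrow> P p"
  shows "convergent_prod (\<lambda>p. if prime p \<and> P p then local_factor \<phi> p else 1)"
proof (intro abs_convergent_prod_imp_convergent_prod summable_imp_abs_convergent_prod)
  have "summable (\<lambda>n. 1 / (real n - 1)\<^sup>2)"
    using inverse_power_summable[of 2, where ?'a = real] summable_Suc_iff[of "\<lambda>n. 1 / (real n - 1)\<^sup>2"]
    by (simp add: inverse_eq_divide)
  then show "summable (\<lambda>p. norm ((if prime p \<and> P p then local_factor \<phi> p else 1) - 1))"
  proof (rule summable_comparison_test'[where N = 3])
    fix p :: nat assume "p \<ge> 3"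
    then show "norm (norm ((if prime p \<and> P p then local_factor \<phi> p else 1) - 1)) \<le> 1 / (real p - 1)\<^sup>2"
      using local_factor_ge[of p] local_factor_le[of p] by auto
  qed
qed

section \<open>Integers with nearly minimal ratio, and the upper bound\<close>

definition witness :: "(nat \<Rightarrow> nat) \<Rightarrow> nat \<Rightarrow> nat \<Rightarrow> nat" where
  "witness \<nu> k y = (\<Prod>p | p \<le> y \<and> prime p. p ^ (if p \<le> k then \<nu> p else e p))"

lemma witness_pos: "witness \<nu> k y > 0"
  unfolding witness_def by (intro prod_pos) (auto simp: prime_gt_0_nat)

text \<open>Any prime above k and 2 divides the witness once y reaches it, because its exponent
  \<open>e p\<close> is positive.\<close>

lemma filterlim_witness: "filterlim (witness \<nu> k) at_top sequentially"
  unfolding filterlim_at_top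
proof
  fix M
  obtain p where p: "prime p" "p > max M (max k 2)"
    using bigger_prime by blast
  show "\<forall>\<^sub>F y in sequentially. M \<le> witness \<nu> k y"
    using eventually_ge_at_top[of p]
  proof eventually_elim
    case (elim y)
    have "p dvd p ^ e p"
      using e_ge_1[of p] p by (intro dvd_power) auto
    also have "p ^ e p = p ^ (if p \<le> k then \<nu> p else e p)"
      using p by simp
    also have "\<dots> dvd witness \<nu> k y"
      unfolding witness_def using p elim by (intro dvd_prodI) auto
    finally have "p \<le> witness \<nu> k y"
      using witness_pos by (rule dvd_imp_le)
    then show ?case
      using p by simp
  qed
qed

text \<open>The factors 1 - 1/p over all p \<le> y are split off for Mertens' theorem. Of the
  quotients that remain, those beyond k together contribute at most exp (1/(k-1)), uniformly in
  y.\<close>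

lemma witness_ratio_le:
  assumes "k \<ge> 2" "k \<le> y"
  shows "\<phi> (witness \<nu> k y) / real (witness \<nu> k y) \<le>
    (\<Prod>n\<le>y. if prime n then 1 - 1 / real n else 1) *
    (\<Prod>n\<le>k. if prime n then ratio n (\<nu> n) / (1 - 1 / real n) else 1) * exp (1 / (real k - 1))"
proof -
  define r where "r = (\<lambda>n. if prime n then ratio n (if n \<le> k then \<nu> n else e n) / (1 - 1 / real n) else 1)"
  have pos: "1 - 1 / real n > 0" if "prime n" for n
    using prime_gt_1_nat[OF that] by simp
  have r0: "r n \<ge> 0" for n
    using pos[of n] ratio_pos[of n] by (auto simp: r_def intro!: divide_nonneg_pos less_imp_le)
  have r_le: "r n \<le> 1 + 1 / (real n - 1)\<^sup>2" if "n > k" for n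
    using pos[of n] ratio_e_le[of n] that assms(1) by (auto simp: r_def pos_divide_le_eq mult.commute)
  have "\<phi> (witness \<nu> k y) / real (witness \<nu> k y) = (\<Prod>p | p \<le> y \<and> prime p. ratio p (if p \<le> k then \<nu> p else e p))"
    unfolding witness_def by (rule phi_ratio_prod) auto
  also have "\<dots> = (\<Prod>n\<le>y. (if prime n then 1 - 1 / real n else 1) * r n)"
    using pos by (intro prod.mono_neutral_cong_left) (auto simp: r_def dest: less_imp_neq)
  also have "\<dots> = (\<Prod>n\<le>y. if prime n then 1 - 1 / real n else 1) * ((\<Prod>n\<le>k. r n) * (\<Prod>n\<in>{k<..y}. r n))"
  proof -
    have "{..y} = {..k} \<union> {k<..y}"
      using assms by auto
    then have "prod r {..y} = prod r {..k} * prod r {k<..y}"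
      using prod.union_disjoint[of "{..k}" "{k<..y}" r] by (simp add: disjoint_iff)
    then show ?thesis
      by (simp add: prod.distrib)
  qed
  also have "\<dots> \<le> (\<Prod>n\<le>y. if prime n then 1 - 1 / real n else 1) * ((\<Prod>n\<le>k. r n) * exp (1 / (real k - 1)))"
  proof (intro mult_left_mono prod_nonneg mult_nonneg_nonneg)
    have "(\<Prod>n\<in>{k<..y}. r n) \<le> (\<Prod>n\<in>{k<..y}. 1 + 1 / (real n - 1)\<^sup>2)"
      using r0 r_le by (intro prod_mono) auto
    also have "\<dots> \<le> exp (1 / (real k - 1) - 1 / (real y - 1))"
      by (rule prod_one_plus_inverse_square_le[OF assms])
    also have "\<dots> \<le> exp (1 / (real k - 1))"
      using assms by simp
    finally show "(\<Prod>n\<in>{k<..y}. r n) \<le> exp (1 / (real k - 1))" .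
  qed (use r0 pos in \<open>auto intro: less_imp_le\<close>)
  also have "(\<Prod>n\<le>k. r n) = (\<Prod>n\<le>k. if prime n then ratio n (\<nu> n) / (1 - 1 / real n) else 1)"
    by (intro prod.cong) (auto simp: r_def)
  finally show ?thesis
    by (simp add: mult_ac)
qed

text \<open>A second logarithm follows, so only the power 1 + \<delta> of y matters: the number of
  primes is bounded by y + 1 and each exponent by C y^\<delta>.\<close>

lemma ln_witness_le:
  assumes "\<delta> > 0"
  obtains C where "C > 0" "\<And>y. y \<ge> 1 \<Longrightarrow> ln (real (witness \<nu> k y)) \<le> (real y + 1) * (C * real y powr \<delta> * ln (real y))"
proof -
  define \<mu> where "\<mu> = (\<lambda>p. if p \<le> k then \<nu> p else e p)"
  obtain P where P: "\<And>p. p \<ge> P \<Longrightarrow> prime p \<Longrightarrow> real (e p) \<le> real p powr \<delta>"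
    using subpolynomial_on_primesD[OF e_subpolynomial assms] by blast
  \<comment> \<open>Absorbs the finitely many exponents up to \<open>max P k\<close>; beyond that
    point the exponents are \<open>e p\<close> and the subpolynomial bound applies.\<close>
  define C where "C = 1 + (\<Sum>n\<le>max P k. real (\<mu> n))"
  have C: "C \<ge> 1"
    by (simp add: C_def sum_nonneg)
  have \<mu>: "real (\<mu> p) \<le> C * real p powr \<delta>" if "prime p" for p
  proof (cases "p \<le> max P k")
    case True
    have "real (\<mu> p) \<le> (\<Sum>n\<le>max P k. real (\<mu> n))"
      using True by (intro member_le_sum) auto
    then have "real (\<mu> p) \<le> C * 1"
      by (simp add: C_def)
    also have "\<dots> \<le> C * real p powr \<delta>"
      using C assms prime_gt_0_nat[OF that] by (intro mult_left_mono ge_one_powr_ge_zero) auto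
    finally show ?thesis .
  next
    case False
    then have "real (\<mu> p) \<le> 1 * real p powr \<delta>"
      using P[of p] that by (auto simp: \<mu>_def)
    also have "\<dots> \<le> C * real p powr \<delta>"
      using C by (intro mult_right_mono) auto
    finally show ?thesis .
  qed
  have "ln (real (witness \<nu> k y)) \<le> (real y + 1) * (C * real y powr \<delta> * ln (real y))" if "y \<ge> 1" for y
  proof -
    have "ln (real (witness \<nu> k y)) = (\<Sum>p | p \<le> y \<and> prime p. ln (real (p ^ \<mu> p)))"
      unfolding witness_def of_nat_prod \<mu>_def by (subst ln_prod) (auto simp: prime_gt_0_nat)
    also have "\<dots> = (\<Sum>p | p \<le> y \<and> prime p. real (\<mu> p) * ln (real p))"
      by (intro sum.cong) (auto simp: ln_realpow prime_gt_0_nat)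
    also have "\<dots> \<le> (\<Sum>p | p \<le> y \<and> prime p. C * real y powr \<delta> * ln (real y))"
    proof (intro sum_mono mult_mono)
      fix p assume p: "p \<in> {p. p \<le> y \<and> prime p}"
      then have "real (\<mu> p) \<le> C * real p powr \<delta>"
        using \<mu> by simp
      also have "\<dots> \<le> C * real y powr \<delta>"
        using C p assms by (intro mult_left_mono powr_mono2) auto
      finally show "real (\<mu> p) \<le> C * real y powr \<delta>" .
      have "0 < p"
        using p by (auto intro: prime_gt_0_nat)
      then show "ln (real p) \<le> ln (real y)" "0 \<le> ln (real p)"
        using p by auto
    qed (use C in auto)
    also have "\<dots> = real (card {p. p \<le> y \<and> prime p}) * (C * real y powr \<delta> * ln (real y))"
      by simp
    also have "\<dots> \<le> (real y + 1) * (C * real y powr \<delta> * ln (real y))"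
    proof (rule mult_right_mono)
      have "card {p. p \<le> y \<and> prime p} \<le> card {..y}"
        by (intro card_mono) auto
      then show "real (card {p. p \<le> y \<and> prime p}) \<le> real y + 1"
        by simp
      show "0 \<le> C * real y powr \<delta> * ln (real y)"
        using C that by simp
    qed
    finally show ?thesis .
  qed
  then show ?thesis
    using that[of C] C by simp
qed

abbreviation loglog_ratio :: "nat \<Rightarrow> real" where
  "loglog_ratio n \<equiv> \<phi> n * ln (ln (real n)) / real n"

text \<open>Along the witnesses, Mertens' product times ln y tends to exp (- \<gamma>), and ln (ln
  N) is at most \<open>b y\<close>, which is asymptotic to (1 + \<delta>) ln y.\<close>

lemma Liminf_le_witness:
  assumes "k \<ge> 2" "\<delta> > 0"
  shows "Liminf sequentially (\<lambda>n. ereal (loglog_ratio n)) \<le>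
    ereal (exp (- euler_mascheroni) * ((\<Prod>n\<le>k. if prime n then ratio n (\<nu> n) / (1 - 1 / real n) else 1) *
      exp (1 / (real k - 1))) * (1 + \<delta>))" (is "_ \<le> ereal (_ * ?c * _)")
proof -
  obtain C where C: "C > 0"
    "\<And>y. y \<ge> 1 \<Longrightarrow> ln (real (witness \<nu> k y)) \<le> (real y + 1) * (C * real y powr \<delta> * ln (real y))"
    using ln_witness_le[OF assms(2)] by metis
  define M where "M = (\<lambda>y. \<Prod>n\<le>y. if prime n then 1 - 1 / real n else 1)"
  define b where "b = (\<lambda>y::nat. ln ((real y + 1) * (C * real y powr \<delta> * ln (real y))))"
  have M0: "M y \<ge> 0" for y
    unfolding M_def using prime_gt_0_nat by (intro prod_nonneg) (auto simp: Suc_le_eq)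
  have c0: "?c \<ge> 0"
    using ratio_pos prime_gt_0_nat
    by (intro mult_nonneg_nonneg prod_nonneg) (auto intro!: divide_nonneg_nonneg less_imp_le[OF ratio_pos] simp: Suc_le_eq)
  have lim_b: "(\<lambda>y. b y / ln (real y)) \<longlonglongrightarrow> 1 + \<delta>"
    unfolding b_def using C(1) assms(2) by real_asymp
  have lim: "(\<lambda>y. (M y * ln (real y)) * ?c * (b y / ln (real y))) \<longlonglongrightarrow> exp (- euler_mascheroni) * ?c * (1 + \<delta>)"
    unfolding M_def by (intro tendsto_intros mertens_third lim_b)
  have "\<forall>\<^sub>F y in sequentially. witness \<nu> k y \<ge> 4"
    using filterlim_witness[of \<nu> k] by (simp add: filterlim_at_top)
  then have ev: "\<forall>\<^sub>F y in sequentially. loglog_ratio (witness \<nu> k y) \<le> (M y * ln (real y)) * ?c * (b y / ln (real y))"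
    using eventually_ge_at_top[of "max k 2"]
  proof eventually_elim
    case (elim y)
    let ?N = "witness \<nu> k y"
    \<comment> \<open>N \<ge> 4 exceeds e, so ln (ln N) is positive and the two upper bounds may be
      multiplied.\<close>
    have "exp 1 < real ?N"
      using exp_le elim(1) by linarith
    then have "ln (exp 1) < ln (real ?N)"
      by (subst ln_less_cancel_iff) (use witness_pos in auto)
    then have lnN: "ln (real ?N) > 1"
      by simp
    have "\<phi> ?N / real ?N \<le> M y * ?c"
      using witness_ratio_le[of k y \<nu>] assms(1) elim by (simp add: M_def mult_ac)
    moreover have "ln (ln (real ?N)) \<le> b y"
    proof -
      have "ln (real ?N) \<le> (real y + 1) * (C * real y powr \<delta> * ln (real y))"
        using C(2)[of y] elim by simp
      then show ?thesis
        unfolding b_def using lnN by (subst ln_le_cancel_iff) auto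
    qed
    ultimately have "\<phi> ?N / real ?N * ln (ln (real ?N)) \<le> M y * ?c * b y"
      using lnN M0 c0 by (intro mult_mono) auto
    then show ?case
      using elim by simp
  qed
  show ?thesis
    by (rule Liminf_le_along[OF filterlim_witness ev lim])
qed

text \<open>An infimum need not be attained, so the exponents at primes up to k come within \<kappa>
  of it; dividing by 1 - 1/p \<ge> 1/2 doubles this slack. The same \<kappa> serves as \<delta>, and
  both losses vanish as j grows with k fixed.\<close>

lemma Liminf_le_partial:
  assumes "k \<ge> 2"
  shows "Liminf sequentially (\<lambda>n. ereal (loglog_ratio n)) \<le>
    ereal (exp (- euler_mascheroni) * ((\<Prod>n\<le>k. if prime n then local_factor \<phi> n else 1) * exp (1 / (real k - 1))))"
proof -
  define \<kappa> where "\<kappa> = (\<lambda>j::nat. 1 / (real j + 1))"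
  define x where "x = (\<lambda>j. exp (- euler_mascheroni) *
    ((\<Prod>n\<le>k. if prime n then local_factor \<phi> n + 2 * \<kappa> j else 1) * exp (1 / (real k - 1))) * (1 + \<kappa> j))"
  have \<kappa>: "\<kappa> j > 0" for j
    by (simp add: \<kappa>_def)
  have "\<kappa> \<longlonglongrightarrow> 0"
    unfolding \<kappa>_def by real_asymp
  then have "(\<lambda>j. if prime n then local_factor \<phi> n + 2 * \<kappa> j else 1) \<longlonglongrightarrow>
      (if prime n then local_factor \<phi> n + 2 * 0 else 1)" for n
    by (cases "prime n") (simp_all only: if_True if_False tendsto_add tendsto_mult tendsto_const)
  then have "x \<longlonglongrightarrow> exp (- euler_mascheroni) *
    ((\<Prod>n\<le>k. if prime n then local_factor \<phi> n + 2 * 0 else 1) * exp (1 / (real k - 1))) * (1 + 0)"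
    unfolding x_def using \<open>\<kappa> \<longlonglongrightarrow> 0\<close> by (intro tendsto_intros)
  moreover have "Liminf sequentially (\<lambda>n. ereal (loglog_ratio n)) \<le> ereal (x j)" for j
  proof -
    have "\<exists>\<nu>. prime p \<longrightarrow> ratio p \<nu> < inf_ratio p + \<kappa> j" for p
      using cInf_lessD[of "range (ratio p)" "inf_ratio p + \<kappa> j"] \<kappa>[of j] by (auto simp: inf_ratio_def)
    then obtain \<nu> where \<nu>: "\<And>p. prime p \<Longrightarrow> ratio p (\<nu> p) < inf_ratio p + \<kappa> j"
      by metis
    have le: "ratio n (\<nu> n) / (1 - 1 / real n) \<le> local_factor \<phi> n + 2 * \<kappa> j" if "prime n" for n
    proof -
      have n: "real n \<ge> 2"
        using prime_ge_2_nat[OF that] by simp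
      have "ratio n (\<nu> n) / (1 - 1 / real n) \<le> (inf_ratio n + \<kappa> j) / (1 - 1 / real n)"
        using \<nu>[OF that] n by (intro divide_right_mono) auto
      also have "\<dots> = local_factor \<phi> n + \<kappa> j / (1 - 1 / real n)"
        by (simp add: local_factor_eq add_divide_distrib)
      also have "\<kappa> j / (1 - 1 / real n) \<le> \<kappa> j / (1 / 2)"
        using n \<kappa>[of j] by (intro divide_left_mono) (auto simp: field_simps)
      finally show ?thesis
        by simp
    qed
    have nonneg: "0 \<le> ratio n (\<nu> n) / (1 - 1 / real n)" if "prime n" for n
      using ratio_pos[OF that, of "\<nu> n"] prime_gt_1_nat[OF that]
      by (intro divide_nonneg_nonneg) auto
    note Liminf_le_witness[OF assms \<kappa>[of j], of \<nu>]
    also have "ereal (exp (- euler_mascheroni) * ((\<Prod>n\<le>k. if prime n then ratio n (\<nu> n) / (1 - 1 / real n) else 1) *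
      exp (1 / (real k - 1))) * (1 + \<kappa> j)) \<le> ereal (x j)"
      unfolding x_def ereal_less_eq using le nonneg \<kappa>[of j]
      by (intro mult_right_mono mult_left_mono prod_mono) auto
    finally show ?thesis .
  qed
  ultimately have "Liminf sequentially (\<lambda>n. ereal (loglog_ratio n)) \<le> ereal (exp (- euler_mascheroni) *
    ((\<Prod>n\<le>k. if prime n then local_factor \<phi> n + 2 * 0 else 1) * exp (1 / (real k - 1))) * (1 + 0))"
    by (intro le_ereal_LIMSEQ) auto
  then show ?thesis
    by (simp cong: if_cong)
qed

section \<open>Passage to the full product in both bounds\<close>

lemma local_factor_prod_LIMSEQ:
  "(\<lambda>k. \<Prod>n\<le>k. if prime n then local_factor \<phi> n else 1) \<longlonglongrightarrow> (\<Prod>p. if prime p then local_factor \<phi> p else 1)"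
  using convergent_prod_LIMSEQ[OF convergent_prod_local_factor[of "\<lambda>_. True"]] by simp

theorem Liminf_upper:
  "Liminf sequentially (\<lambda>n. ereal (loglog_ratio n)) \<le>
    ereal (exp (- euler_mascheroni) * (\<Prod>p. if prime p then local_factor \<phi> p else 1))"
proof -
  have "(\<lambda>k::nat. exp (1 / (real k - 1))) \<longlonglongrightarrow> 1"
    by real_asymp
  then have "(\<lambda>k. exp (- euler_mascheroni) * ((\<Prod>n\<le>k. if prime n then local_factor \<phi> n else 1) * exp (1 / (real k - 1))))
      \<longlonglongrightarrow> exp (- euler_mascheroni) * ((\<Prod>p. if prime p then local_factor \<phi> p else 1) * 1)"
    by (intro tendsto_intros local_factor_prod_LIMSEQ)
  moreover have "\<forall>\<^sub>F k in sequentially. Liminf sequentially (\<lambda>n. ereal (loglog_ratio n)) \<le>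
      ereal (exp (- euler_mascheroni) * ((\<Prod>n\<le>k. if prime n then local_factor \<phi> n else 1) * exp (1 / (real k - 1))))"
    using eventually_ge_at_top[of 2] by eventually_elim (rule Liminf_le_partial)
  ultimately show ?thesis
    using le_ereal_LIMSEQ by fastforce
qed

text \<open>\<open>phi_ratio_lower\<close> is applied with y the floor of ln n. Replacing ln y by
  the larger ln (ln n) only helps, and the correction for large prime factors tends to 1.\<close>

theorem Liminf_lower:
  "ereal (exp (- euler_mascheroni) * (\<Prod>p. if prime p then local_factor \<phi> p else 1)) \<le>
    Liminf sequentially (\<lambda>n. ereal (loglog_ratio n))"
proof -
  define c where "c = (\<lambda>y::nat. inf_prod y * ln (real y) * (1 - (real y + 1) / (real y * ln (real y + 1))))"
  have "(\<lambda>y. ((\<Prod>n\<le>y. if prime n then 1 - 1 / real n else 1) * ln (real y)) *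
      (\<Prod>n\<le>y. if prime n then local_factor \<phi> n else 1)) \<longlonglongrightarrow>
      exp (- euler_mascheroni) * (\<Prod>p. if prime p then local_factor \<phi> p else 1)"
    by (intro tendsto_mult mertens_third local_factor_prod_LIMSEQ)
  then have 1: "(\<lambda>y. inf_prod y * ln (real y)) \<longlonglongrightarrow>
      exp (- euler_mascheroni) * (\<Prod>p. if prime p then local_factor \<phi> p else 1)"
    by (simp add: inf_prod_eq mult_ac)
  have "(\<lambda>y::nat. 1 - (real y + 1) / (real y * ln (real y + 1))) \<longlonglongrightarrow> 1"
    by real_asymp
  from tendsto_mult[OF 1 this] have c: "c \<longlonglongrightarrow> exp (- euler_mascheroni) * (\<Prod>p. if prime p then local_factor \<phi> p else 1)"
    by (simp add: c_def)
  have "filterlim (\<lambda>n::nat. nat \<lfloor>ln (real n)\<rfloor>) at_top sequentially"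
    by real_asymp
  from filterlim_compose[OF c this]
  have lim: "(\<lambda>n. ereal (c (nat \<lfloor>ln (real n)\<rfloor>))) \<longlonglongrightarrow>
      ereal (exp (- euler_mascheroni) * (\<Prod>p. if prime p then local_factor \<phi> p else 1))"
    by (rule tendsto_ereal)
  have "\<forall>\<^sub>F n::nat in sequentially. ln (real n) \<ge> 2"
    by real_asymp
  then have "\<forall>\<^sub>F n in sequentially. ereal (c (nat \<lfloor>ln (real n)\<rfloor>)) \<le> ereal (loglog_ratio n)"
    using eventually_ge_at_top[of 1]
  proof eventually_elim
    case (elim n)
    define y where "y = nat \<lfloor>ln (real n)\<rfloor>"
    have y: "y \<ge> 2" "real y \<le> ln (real n)" "ln (real n) \<le> real y + 1"
      using elim by (auto simp: y_def le_nat_iff le_floor_iff)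
    have "inf_prod y * (1 - (real y + 1) / (real y * ln (real y + 1))) \<le> \<phi> n / real n"
      by (rule phi_ratio_lower) (use elim y in auto)
    then have "c y \<le> \<phi> n / real n * ln (real y)"
      using mult_right_mono[of _ _ "ln (real y)"] y by (fastforce simp: c_def mult_ac)
    also have "\<dots> \<le> \<phi> n / real n * ln (ln (real n))"
    proof (intro mult_left_mono)
      have "\<phi> n / real n = (\<Prod>p\<in>prime_factors n. ratio p (multiplicity p n))"
        using elim by (intro phi_ratio_eq) auto
      then show "0 \<le> \<phi> n / real n"
        by (auto intro!: prod_nonneg less_imp_le[OF ratio_pos])
    qed (use y in auto)
    finally show ?case
      by (simp add: y_def)
  qed
  then have "Liminf sequentially (\<lambda>n. ereal (c (nat \<lfloor>ln (real n)\<rfloor>))) \<le> Liminf sequentially (\<lambda>n. ereal (loglog_ratio n))"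
    by (rule Liminf_mono)
  then show ?thesis
    using lim_imp_Liminf[OF _ lim] by simp
qed

end

section \<open>A system with vanishing factor at two\<close>

text \<open>
  On powers of two, \<open>A (2 ^ j) = {2 ^ j}\<close> unless \<open>j = 2 ^ k\<close>, so that \<open>\<phi>\<^sub>A (2 ^ j) = 2 ^ j\<close> for these \<open>j\<close>;
  at \<open>j = 2 ^ k\<close> the divisors \<open>2 ^ i\<close> with \<open>j / 2 < i < j\<close> then leave only \<open>2 ^ (j / 2 + 1)\<close> for \<open>\<phi>\<^sub>A (2 ^ j)\<close>.
\<close>

definition sparse_link :: "nat \<Rightarrow> nat \<Rightarrow> bool" where
  "sparse_link i j \<longleftrightarrow> i = j \<or> (\<exists>k. j = 2 ^ k) \<and> j < 2 * i"

definition sparse_system :: "nat \<Rightarrow> nat set" where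
  "sparse_system n = {d. d dvd n \<and> sparse_link (multiplicity 2 d) (multiplicity 2 n)}"

lemma sparse_link_zero: "sparse_link 0 0"
  by (simp add: sparse_link_def)

lemma sparse_system_self: "n \<in> sparse_system n"
  by (simp add: sparse_system_def sparse_link_def)

lemma divisor_system_sparse: "divisor_system sparse_system"
  by (auto simp: divisor_system_def sparse_system_def)

text \<open>At most one of two coprime numbers is even, so the 2-adic valuations of the products
  come from one factor pair alone; the other pair satisfies the link condition as 0 and 0.\<close>

lemma mem_sparse_system_mult:
  assumes "coprime m n" "m \<ge> 1" "n \<ge> 1" "a dvd m" "b dvd n"
  shows "a * b \<in> sparse_system (m * n) \<longleftrightarrow> a \<in> sparse_system m \<and> b \<in> sparse_system n"
proof -
  have nz: "a \<noteq> 0" "b \<noteq> 0" "m \<noteq> 0" "n \<noteq> 0"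
    using assms by auto
  have mult: "multiplicity 2 (a * b) = multiplicity 2 a + multiplicity 2 b"
    "multiplicity 2 (m * n) = multiplicity 2 m + multiplicity 2 n"
    using nz by (simp_all add: prime_elem_multiplicity_mult_distrib)
  have "multiplicity 2 m = 0 \<or> multiplicity 2 n = 0"
    using assms(1) by (metis coprime_common_divisor_nat not_dvd_imp_multiplicity_0 numeral_eq_one_iff semiring_norm(85))
  moreover have "multiplicity 2 a \<le> multiplicity 2 m" "multiplicity 2 b \<le> multiplicity 2 n"
    using assms nz by (auto intro: dvd_imp_multiplicity_le)
  moreover have "a * b dvd m * n"
    using assms by (intro mult_dvd_mono)
  ultimately show ?thesis
    using assms by (auto simp: sparse_system_def mult sparse_link_zero)
qed

lemma multiplicative_system_sparse: "multiplicative_system sparse_system"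
  unfolding multiplicative_system_def
proof (intro conjI allI impI)
  show "\<exists>n\<ge>1. sparse_system n \<noteq> {}"
    using sparse_system_self[of 1] by auto
  fix m n :: nat assume mn: "m \<ge> 1" "n \<ge> 1" "coprime m n"
  show "sparse_system (m * n) = {d1 * d2 | d1 d2. d1 \<in> sparse_system m \<and> d2 \<in> sparse_system n}"
  proof (intro equalityI subsetI)
    fix d assume d: "d \<in> sparse_system (m * n)"
    then have "d dvd m * n"
      by (simp add: sparse_system_def)
    then obtain a b where "d = a * b" "a dvd m" "b dvd n"
      by (rule dvd_productE)
    then show "d \<in> {d1 * d2 | d1 d2. d1 \<in> sparse_system m \<and> d2 \<in> sparse_system n}"
      using d mem_sparse_system_mult[of m n a b] mn by auto
  next
    fix d assume "d \<in> {d1 * d2 | d1 d2. d1 \<in> sparse_system m \<and> d2 \<in> sparse_system n}"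
    then obtain a b where d: "d = a * b" "a \<in> sparse_system m" "b \<in> sparse_system n"
      by auto
    then have "a dvd m" "b dvd n"
      by (auto simp: sparse_system_def)
    then show "d \<in> sparse_system (m * n)"
      using d mem_sparse_system_mult[of m n a b] mn by auto
  qed
qed

text \<open>For odd p the link condition is trivial, hence 1 \<in> A p and the constant exponent 1
  works, being p^0.\<close>

lemma exponent_condition_sparse: "exponent_condition sparse_system"
  unfolding exponent_condition_def
proof (intro exI[of _ "\<lambda>_. 1"] conjI allI impI)
  fix p :: nat assume p: "prime p \<and> p > 2"
  then have "odd p"
    using prime_odd_nat by auto
  then show "p ^ (1 - 1) \<in> sparse_system (p ^ 1)"
    by (simp add: sparse_system_def sparse_link_zero not_dvd_imp_multiplicity_0)
next
  have "\<forall>\<^sub>F p in primes_at_top. real 1 = real p powr 0"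
    unfolding primes_at_top_def eventually_inf_principal
    by (rule always_eventually) (simp add: prime_gt_0_nat)
  then show "subpolynomial_on_primes (\<lambda>_. 1)"
    unfolding subpolynomial_on_primes_def by (intro exI[of _ "\<lambda>_. 0"]) auto
qed simp

lemma sum_power2_segment: "m \<le> n \<Longrightarrow> (\<Sum>i\<in>{m..<n}. 2 ^ i) = (2 ^ n - 2 ^ m :: real)"
  by (induction n rule: dec_induct) auto

lemma mem_sparse_system_power2: "2 ^ i \<in> sparse_system (2 ^ j) \<longleftrightarrow> i \<le> j \<and> sparse_link i j"
  by (auto simp: sparse_system_def le_imp_power_dvd dest: power_dvd_imp_le)

lemma inf_ratio_sparse:
  assumes "phi_system sparse_system \<psi>"
  shows "phi_system.inf_ratio \<psi> 2 = 0"
proof -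
  interpret phi_system sparse_system \<psi>
    by fact
  \<comment> \<open>Strictly between consecutive powers of two, i is not itself a power of two, so
    the recursion subtracts nothing.\<close>
  have phi_id: "\<psi> (2 ^ i) = 2 ^ i" if i: "2 ^ k < i" "i < 2 ^ Suc k" for i k
  proof -
    have "i \<noteq> 2 ^ l" for l
    proof
      assume "i = 2 ^ l"
      then have "k < l" "l < Suc k"
        using i power_strict_increasing_iff[of "2 :: nat"] by (simp_all del: power_Suc)
      then show False
        by simp
    qed
    then have empty: "{d. d \<in> sparse_system (2 ^ i) \<and> d < 2 ^ i} = {}"
      using A_prime_power_strict[of 2 i] by (auto simp: mem_sparse_system_power2 sparse_link_def)
    show ?thesis
      by (subst phi_prime_power_split) (simp_all add: empty)
  qed
  \<comment> \<open>The strict inequality in \<open>sparse_link\<close> excludes i = 2^k, where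
    \<open>phi_id\<close> does not apply; every subtracted value is therefore known, and their sum
    is a geometric segment.\<close>
  have ratio: "ratio 2 (2 ^ Suc k) = 2 / 2 ^ 2 ^ k" for k
  proof -
    have "{d. d \<in> sparse_system (2 ^ 2 ^ Suc k) \<and> d < 2 ^ 2 ^ Suc k} = (\<lambda>i. 2 ^ i) ` {Suc (2 ^ k)..<2 ^ Suc k}"
    proof (intro equalityI subsetI)
      fix d :: nat assume d: "d \<in> {d. d \<in> sparse_system (2 ^ 2 ^ Suc k) \<and> d < 2 ^ 2 ^ Suc k}"
      then obtain i where i: "i < 2 ^ Suc k" "d = 2 ^ i"
        using A_prime_power_strict[of 2 "2 ^ Suc k"] by auto
      then show "d \<in> (\<lambda>i. 2 ^ i) ` {Suc (2 ^ k)..<2 ^ Suc k}"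
        using d by (auto simp: mem_sparse_system_power2 sparse_link_def)
    next
      fix d :: nat assume "d \<in> (\<lambda>i. 2 ^ i) ` {Suc (2 ^ k)..<2 ^ Suc k}"
      then obtain i where i: "2 ^ k < i" "i < 2 ^ Suc k" "d = 2 ^ i"
        by auto
      then have "sparse_link i (2 ^ Suc k)"
        unfolding sparse_link_def by (intro disjI2 conjI exI[of _ "Suc k"]) auto
      then show "d \<in> {d. d \<in> sparse_system (2 ^ 2 ^ Suc k) \<and> d < 2 ^ 2 ^ Suc k}"
        using i by (simp only: mem_Collect_eq mem_sparse_system_power2) simp
    qed
    then have "(\<Sum>d | d \<in> sparse_system (2 ^ 2 ^ Suc k) \<and> d < 2 ^ 2 ^ Suc k. \<psi> d) =
        (\<Sum>i\<in>{Suc (2 ^ k)..<2 ^ Suc k}. \<psi> (2 ^ i))"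
      by (simp only:) (subst sum.reindex, auto simp: inj_on_def)
    then have "\<psi> (2 ^ 2 ^ Suc k) = 2 ^ 2 ^ Suc k - (\<Sum>i\<in>{Suc (2 ^ k)..<2 ^ Suc k}. \<psi> (2 ^ i))"
      using phi_prime_power_split[of 2 "2 ^ Suc k"] by simp
    also have "(\<Sum>i\<in>{Suc (2 ^ k)..<2 ^ Suc k}. \<psi> (2 ^ i)) = (\<Sum>i\<in>{Suc (2 ^ k)..<2 ^ Suc k}. 2 ^ i)"
      using phi_id[of k] by (intro sum.cong) auto
    also have "\<dots> = 2 ^ 2 ^ Suc k - 2 ^ Suc (2 ^ k)"
      by (rule sum_power2_segment) (simp add: Suc_le_eq)
    finally have "\<psi> (2 ^ 2 ^ Suc k) = 2 * 2 ^ 2 ^ k"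
      by simp
    moreover have "(2 :: real) ^ 2 ^ Suc k = 2 ^ 2 ^ k * 2 ^ 2 ^ k"
      by (simp add: mult_2 power_add)
    ultimately show ?thesis
      by (simp add: ratio_def)
  qed
  have "inf_ratio 2 \<le> 2 / 2 ^ 2 ^ k" for k
    using inf_ratio_le[of 2 "2 ^ Suc k"] ratio[of k] by simp
  moreover have "(\<lambda>k. 2 / 2 ^ 2 ^ k :: real) \<longlonglongrightarrow> 0"
    by real_asymp
  ultimately have "inf_ratio 2 \<le> 0"
    by (intro LIMSEQ_le_const) auto
  then show ?thesis
    using inf_ratio_nonneg[of 2] by simp
qed

text \<open>This gives substance to the remark that the factor at 2 may vanish: all hypotheses are
  compatible with it.\<close>

lemma vanishing_local_factor_exists:
  "\<exists>B \<psi>. divisor_system B \<and> multiplicative_system B \<and> (\<forall>n\<ge>1. n \<in> B n) \<and>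
     is_phi B \<psi> \<and> exponent_condition B \<and> local_factor \<psi> 2 = 0"
proof -
  obtain \<psi> where \<psi>: "is_phi sparse_system \<psi>"
    using is_phi_exists[OF divisor_system_sparse] sparse_system_self by blast
  interpret phi_system sparse_system \<psi>
    by unfold_locales (use divisor_system_sparse multiplicative_system_sparse sparse_system_self \<psi> in auto)
  have "local_factor \<psi> 2 = 0"
    using inf_ratio_sparse[OF phi_system_axioms] by (simp add: local_factor_eq)
  then show ?thesis
    using divisor_system_sparse multiplicative_system_sparse sparse_system_self \<psi> exponent_condition_sparse
    by blast
qed

theorem theorem7:
  fixes A :: "nat \<Rightarrow> nat set" and \<phi> :: "nat \<Rightarrow> real"
  assumes "divisor_system A" and "multiplicative_system A" and "\<forall>n\<ge>1. n \<in> A n"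
    and "is_phi A \<phi>"
    and "exponent_condition A"
  shows "Liminf sequentially (\<lambda>n. ereal (\<phi> n * ln (ln (real n)) / real n)) =
           ereal (exp (- euler_mascheroni) * (\<Prod>p. if prime p then local_factor \<phi> p else 1))
       \<and> convergent_prod (\<lambda>p. if prime p \<and> p > 2 then local_factor \<phi> p else 1)
       \<and> (local_factor \<phi> 2 = 0 \<longrightarrow>
            exp (- euler_mascheroni) * (\<Prod>p. if prime p then local_factor \<phi> p else 1) = 0)
       \<and> (\<exists>B \<psi>. divisor_system B \<and> multiplicative_system B \<and> (\<forall>n\<ge>1. n \<in> B n) \<and>
              is_phi B \<psi> \<and> exponent_condition B \<and> local_factor \<psi> 2 = 0)"
proof -
  obtain e where e: "\<And>p. prime p \<and> p > 2 \<Longrightarrow> e p \<ge> 1 \<and> p ^ (e p - 1) \<in> A (p ^ e p)"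
    "subpolynomial_on_primes e"
    using assms(5) unfolding exponent_condition_def by blast
  interpret phi_system_exponents A \<phi> e
    by unfold_locales (use assms e in auto)
  \<comment> \<open>From k = 2 on every partial product contains the zero factor, and the partial
    products converge to the infinite product.\<close>
  have "(\<Prod>p. if prime p then local_factor \<phi> p else 1) = 0" if "local_factor \<phi> 2 = 0"
  proof (rule LIMSEQ_unique[OF local_factor_prod_LIMSEQ])
    have "\<forall>\<^sub>F k in sequentially. (\<Prod>n\<le>k. if prime n then local_factor \<phi> n else 1) = 0"
      using eventually_ge_at_top[of 2]
      by eventually_elim (rule prod_zero, use that in \<open>auto intro!: bexI[of _ 2]\<close>)
    then show "(\<lambda>k. \<Prod>n\<le>k. if prime n then local_factor \<phi> n else 1) \<longlonglongrightarrow> 0"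
      by (rule tendsto_eventually)
  qed
  then show ?thesis
    using Liminf_upper Liminf_lower convergent_prod_local_factor[of "\<lambda>p. p > 2"]
      vanishing_local_factor_exists
    by (simp add: antisym)
qed

end
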